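(* Suppose that $\phi^0\in C^0(\bar\Omega;\mathbb{R})$ satisfies $\phi^0>0$ on $\Omega^+(0)$, $\phi^0<0$ on $\Omega^-(0)$, $\{x\in\Omega\mid\phi^0(x)=0\}=\Sigma(0)$ and $\phi^0|_{\partial\Omega}=0$. Then there exists a unique viscosity solution $\phi\in C^0([0,\infty)\times\bar\Omega;\mathbb{R})$ of $$\begin{cases}\dfrac{\partial\phi}{\partial t}(t,x)+v\Big(t,\,x-\dfrac{\phi(t,x)\nabla\phi(t,x)}{|\nabla\phi(t,x)|^2+\eta(|\nabla\phi(t,x)|^2)}\Big)\cdot\nabla\phi(t,x)=0&\text{in }(0,\infty)\times\Omega,\\ \phi(0,x)=\phi^0(x)&\text{on }\Omega,\\ \phi(t,x)=0&\text{on }[0,\infty)\times\partial\Omega,\end{cases}$$ i.e., $\phi$ satisfies the PDE in the sense of viscosity solutions and the initial/boundary condition in the classical sense. Furthermore, for all $t\ge0$, $$\phi(t,\cdot)>0\text{ in }\Omega^+(t),\qquad\phi(t,\cdot)<0\text{ in }\Omega^-(t),\qquad\phi(t,\cdot)=0\text{ on }\Sigma(t).$$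
   Context: Setting. $\Omega\subset\mathbb{R}^3$ is a bounded connected open set and $v=v(t,x):[0,\infty)\times\bar\Omega\to\mathbb{R}^3$ is a given function satisfying: (H1) $v\in C^0([0,\infty)\times\bar\Omega;\mathbb{R}^3)\cap C^1([0,\infty)\times\Omega;\mathbb{R}^3)$; $v$ is Lipschitz continuous in $x$ on $[0,\infty)\times\bar\Omega$; $v$ is twice partially differentiable in $x$; all of these partial derivatives of $v$ belong to $C^0([0,\infty)\times\Omega;\mathbb{R}^3)$. (H2) $\pm v(s,x)\in T_{\partial\Omega}(x)$ for all $(s,x)\in[0,\infty)\times\partial\Omega$, where $T_{\partial\Omega}(x):=\{z\in\mathbb{R}^3\mid\liminf_{h\to0+}\mathrm{dist}(x+hz,\partial\Omega)/h=0\}$. No regularity of $\partial\Omega$ is assumed. $X(s,\tau,\xi)$ denotes the flow of $x'(s)=v(s,x(s))$ on $\bar\Omega$, i.e. $s\mapsto X(s,\tau,\xi)$ is the unique solution with $x(\tau)=\xi$; by (H1), (H2), $\Omega$ and $\partial\Omega$ are forward and backward flow invariant for times in $[0,\infty)$. $\Omega^+(0)\subset\Omega$ is a subdomain such that $\Sigma(0):=\partial\Omega^+(0)$ is a closed $C^2$-smooth surface with $\Sigma(0)\cap\partial\Omega=\emptyset$, and $\Omega^-(0):=\Omega\setminus(\Omega^+(0)\cup\Sigma(0))$. For $t\ge0$, $\Omega^\pm(t):=X(t,0,\Omega^\pm(0))$ and $\Sigma(t):=X(t,0,\Sigma(0))$. Extension of $v$: $v$ is extended to a function on $[0,\infty)\times\mathbb{R}^3$,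 still denoted by $v$, which is continuous in $(t,x)$ and Lipschitz continuous in $x$ (uniformly in $t$). If $\lambda$ is a Lipschitz constant in $x$ of the components $v_i$, such an extension is given by $v_i(t,x):=\inf_{z\in\bar\Omega}\{v_i(t,z)+\lambda|x-z|\}$, $i=1,2,3$. Cut-off: $\eta:[0,\infty)\to[0,1]$ is a $C^1$-function with $\eta(0)=1$, $\eta(r)=0$ for $r\ge r_\ast$ with some fixed $r_\ast\in(0,1)$, and $\eta$ monotone decreasing in between. Viscosity solutions: Let $O\subset\mathbb{R}^N$ be open and $\mathcal{H}:O\times\mathbb{R}\times\mathbb{R}^N\to\mathbb{R}$ continuous. For a locally bounded $u:O\to\mathbb{R}$ let $u^\ast$, $u_\ast$ be its upper/lower semicontinuous envelopes, $u^\ast(z)=\lim_{r\to0}\sup\{u(y)\mid y\in O,\,|y-z|\le r\}$ and $u_\ast(z)=\lim_{r\to0}\inf\{u(y)\mid y\in O,\,|y-z|\le r\}$. $u$ is a viscosity subsolution (resp. supersolution) of $\mathcal{H}(z,u(z),\nabla_zu(z))=0$ in $O$ if $u^\ast$ is bounded from above (resp. $u_\ast$ is bounded from below) and, whenever $(\varphi,z)\in C^1(O;\mathbb{R})\times O$ is such that $u^\ast-\varphi$ has a local maximum (resp. $u_\ast-\varphi$ has a local minimum) at $z$, one has $\mathcal{H}(z,u^\ast(z),\nabla\varphi(z))\le0$ (resp. $\mathcal{H}(z,u_\ast(z),\nabla\varphi(z))\ge0$). A viscosity solution is a function that is both a viscosity subsolution and a viscosity supersolution. Here this is applied with $z=(t,x)$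 and $O=(0,\infty)\times\Omega$. *)

theory Defs
  imports "HOL-Analysis.Analysis"
begin

text \<open>Continuous differentiability on a set. At non-interior points (time \<open>0\<close> in
  \<open>[0,\<infinity>) \<times> \<Omega>\<close>) the derivative is taken relative to the set, i.e. one-sided in time.\<close>

definition C1_on :: "'a::real_normed_vector set \<Rightarrow> ('a \<Rightarrow> 'b::real_normed_vector) \<Rightarrow> bool" where
  "C1_on S f \<longleftrightarrow> (\<exists>f'. (\<forall>z\<in>S. (f has_derivative blinfun_apply (f' z)) (at z within S)) \<and>
                   continuous_on S f')"

section \<open>Viscosity solutions of $H(z,u,\nabla u) = 0$ on an open set\<close>

text \<open>The suprema and infima below are those of the reals, so the envelopes are meaningful only
  for locally bounded \<open>u\<close>, which the notions of sub- and supersolution require.\<close>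

definition locally_bounded_on :: "'a::euclidean_space set \<Rightarrow> ('a \<Rightarrow> real) \<Rightarrow> bool" where
  "locally_bounded_on Q u \<longleftrightarrow> (\<forall>z\<in>Q. \<exists>r>0. bounded (u ` (Q \<inter> cball z r)))"

definition usc_env :: "'a::euclidean_space set \<Rightarrow> ('a \<Rightarrow> real) \<Rightarrow> 'a \<Rightarrow> real" where
  "usc_env Q u z = Lim (at_right 0) (\<lambda>r. SUP y\<in>Q \<inter> cball z r. u y)"

definition lsc_env :: "'a::euclidean_space set \<Rightarrow> ('a \<Rightarrow> real) \<Rightarrow> 'a \<Rightarrow> real" where
  "lsc_env Q u z = Lim (at_right 0) (\<lambda>r. INF y\<in>Q \<inter> cball z r. u y)"

definition local_max_at :: "'a::euclidean_space set \<Rightarrow> ('a \<Rightarrow> real) \<Rightarrow> 'a \<Rightarrow> bool" where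
  "local_max_at Q f z \<longleftrightarrow> (\<exists>e>0. \<forall>y\<in>Q \<inter> ball z e. f y \<le> f z)"

definition local_min_at :: "'a::euclidean_space set \<Rightarrow> ('a \<Rightarrow> real) \<Rightarrow> 'a \<Rightarrow> bool" where
  "local_min_at Q f z \<longleftrightarrow> (\<exists>e>0. \<forall>y\<in>Q \<inter> ball z e. f z \<le> f y)"

definition viscosity_subsolution ::
  "'a::euclidean_space set \<Rightarrow> ('a \<Rightarrow> real \<Rightarrow> 'a \<Rightarrow> real) \<Rightarrow> ('a \<Rightarrow> real) \<Rightarrow> bool" where
  "viscosity_subsolution Q H u \<longleftrightarrow>
     locally_bounded_on Q u \<and> bdd_above (usc_env Q u ` Q) \<and>
     (\<forall>\<phi> z p. C1_on Q \<phi> \<and> z \<in> Q \<and> local_max_at Q (\<lambda>y. usc_env Q u y - \<phi> y) z \<and>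
        GDERIV \<phi> z :> p \<longrightarrow> H z (usc_env Q u z) p \<le> 0)"

definition viscosity_supersolution ::
  "'a::euclidean_space set \<Rightarrow> ('a \<Rightarrow> real \<Rightarrow> 'a \<Rightarrow> real) \<Rightarrow> ('a \<Rightarrow> real) \<Rightarrow> bool" where
  "viscosity_supersolution Q H u \<longleftrightarrow>
     locally_bounded_on Q u \<and> bdd_below (lsc_env Q u ` Q) \<and>
     (\<forall>\<phi> z p. C1_on Q \<phi> \<and> z \<in> Q \<and> local_min_at Q (\<lambda>y. lsc_env Q u y - \<phi> y) z \<and>
        GDERIV \<phi> z :> p \<longrightarrow> H z (lsc_env Q u z) p \<ge> 0)"

definition viscosity_solution ::
  "'a::euclidean_space set \<Rightarrow> ('a \<Rightarrow> real \<Rightarrow> 'a \<Rightarrow> real) \<Rightarrow> ('a \<Rightarrow> real) \<Rightarrow> bool" where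
  "viscosity_solution Q H u \<longleftrightarrow> viscosity_subsolution Q H u \<and> viscosity_supersolution Q H u"

section \<open>Velocity field, its extension, and its flow\<close>

text \<open>Only the values of \<open>v t x\<close> with \<open>t \<ge> 0\<close> and \<open>x \<in> closure \<Omega>\<close> matter here; \<open>D i\<close> and
  \<open>D2 i j\<close> are the first and second partial derivatives of \<open>v\<close> in space.\<close>

definition velocity_regular :: "(real^3) set \<Rightarrow> (real \<Rightarrow> real^3 \<Rightarrow> real^3) \<Rightarrow> bool" where
  "velocity_regular \<Omega> v \<longleftrightarrow>
     continuous_on ({0..} \<times> closure \<Omega>) (\<lambda>(t, x). v t x) \<and>
     C1_on ({0..} \<times> \<Omega>) (\<lambda>(t, x). v t x) \<and>
     (\<exists>L. \<forall>t\<ge>0. L-lipschitz_on (closure \<Omega>) (v t)) \<and>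
     (\<exists>(D :: 3 \<Rightarrow> real \<Rightarrow> real^3 \<Rightarrow> real^3) (D2 :: 3 \<Rightarrow> 3 \<Rightarrow> real \<Rightarrow> real^3 \<Rightarrow> real^3).
        (\<forall>i. \<forall>t\<ge>0. \<forall>x\<in>\<Omega>.
           ((\<lambda>h. v t (x + h *\<^sub>R axis i 1)) has_vector_derivative D i t x) (at 0)) \<and>
        (\<forall>i j. \<forall>t\<ge>0. \<forall>x\<in>\<Omega>.
           ((\<lambda>h. D i t (x + h *\<^sub>R axis j 1)) has_vector_derivative D2 i j t x) (at 0)) \<and>
        (\<forall>i. continuous_on ({0..} \<times> \<Omega>) (\<lambda>(t, x). D i t x)) \<and>
        (\<forall>i j. continuous_on ({0..} \<times> \<Omega>) (\<lambda>(t, x). D2 i j t x)))"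

definition bouligand_cone :: "'a::euclidean_space set \<Rightarrow> 'a \<Rightarrow> 'a set" where
  "bouligand_cone K x =
     {z. Liminf (at_right 0) (\<lambda>h. ereal (infdist (x + h *\<^sub>R z) K / h)) = 0}"

definition velocity_tangential :: "(real^3) set \<Rightarrow> (real \<Rightarrow> real^3 \<Rightarrow> real^3) \<Rightarrow> bool" where
  "velocity_tangential \<Omega> v \<longleftrightarrow>
     (\<forall>s\<ge>0. \<forall>x\<in>frontier \<Omega>. v s x \<in> bouligand_cone (frontier \<Omega>) x \<and>
                          - v s x \<in> bouligand_cone (frontier \<Omega>) x)"

definition velocity_extension ::
  "(real^3) set \<Rightarrow> (real \<Rightarrow> real^3 \<Rightarrow> real^3) \<Rightarrow> (real \<Rightarrow> real^3 \<Rightarrow> real^3) \<Rightarrow> bool" where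
  "velocity_extension \<Omega> v V \<longleftrightarrow>
     (\<forall>t\<ge>0. \<forall>x\<in>closure \<Omega>. V t x = v t x) \<and>
     continuous_on ({0..} \<times> UNIV) (\<lambda>(t, x). V t x) \<and>
     (\<exists>L. \<forall>t\<ge>0. L-lipschitz_on UNIV (V t))"

definition trajectory ::
  "(real^3) set \<Rightarrow> (real \<Rightarrow> real^3 \<Rightarrow> real^3) \<Rightarrow> (real \<Rightarrow> real^3) \<Rightarrow> bool" where
  "trajectory \<Omega> v x \<longleftrightarrow>
     (\<forall>s\<ge>0. x s \<in> closure \<Omega> \<and> (x has_vector_derivative v s (x s)) (at s within {0..}))"

text \<open>\<open>flow \<Omega> v s \<tau> \<xi>\<close> is $X(s,\tau,\xi)$. The description ranges over the value at time \<open>s\<close>,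
  since a trajectory is unique only on \<open>[0,\<infinity>)\<close>.\<close>

definition flow ::
  "(real^3) set \<Rightarrow> (real \<Rightarrow> real^3 \<Rightarrow> real^3) \<Rightarrow> real \<Rightarrow> real \<Rightarrow> real^3 \<Rightarrow> real^3" where
  "flow \<Omega> v s \<tau> \<xi> = (THE y. \<exists>x. trajectory \<Omega> v x \<and> x \<tau> = \<xi> \<and> x s = y)"

section \<open>Interface, cut-off and the modified level set equation\<close>

text \<open>Compact and without boundary, locally a regular level set of a \<open>C\<^sup>2\<close> function \<open>g\<close>
  with gradient \<open>G\<close>.\<close>

definition closed_C2_surface :: "(real^3) set \<Rightarrow> bool" where
  "closed_C2_surface S \<longleftrightarrow> compact S \<and>
     (\<forall>p\<in>S. \<exists>U g G. open U \<and> p \<in> U \<and>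
        (\<forall>x\<in>U. GDERIV g x :> G x \<and> G x \<noteq> 0) \<and> C1_on U G \<and>
        S \<inter> U = {x\<in>U. g x = 0})"

definition cutoff :: "real \<Rightarrow> (real \<Rightarrow> real) \<Rightarrow> bool" where
  "cutoff rs \<eta> \<longleftrightarrow> 0 < rs \<and> rs < 1 \<and>
     (\<forall>r\<ge>0. 0 \<le> \<eta> r \<and> \<eta> r \<le> 1) \<and> C1_on {0..} \<eta> \<and>
     \<eta> 0 = 1 \<and> (\<forall>r\<ge>rs. \<eta> r = 0) \<and> antimono_on {0..rs} \<eta>"

text \<open>The space-time gradient is the pair \<open>(p\<^sub>t, p)\<close> of its time and space components.\<close>

definition level_set_op ::
  "(real \<Rightarrow> real^3 \<Rightarrow> real^3) \<Rightarrow> (real \<Rightarrow> real) \<Rightarrow>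
   real \<times> (real^3) \<Rightarrow> real \<Rightarrow> real \<times> (real^3) \<Rightarrow> real" where
  "level_set_op V \<eta> = (\<lambda>(t, x) u (p\<^sub>t, p).
     p\<^sub>t + V t (x - (u / ((norm p)\<^sup>2 + \<eta> ((norm p)\<^sup>2))) *\<^sub>R p) \<bullet> p)"

definition level_set_solution ::
  "(real^3) set \<Rightarrow> (real \<Rightarrow> real^3 \<Rightarrow> real^3) \<Rightarrow> (real \<Rightarrow> real) \<Rightarrow> (real^3 \<Rightarrow> real) \<Rightarrow>
   (real \<times> (real^3) \<Rightarrow> real) \<Rightarrow> bool" where
  "level_set_solution \<Omega> V \<eta> \<phi>0 \<phi> \<longleftrightarrow>
     continuous_on ({0..} \<times> closure \<Omega>) \<phi> \<and>
     viscosity_solution ({0<..} \<times> \<Omega>) (level_set_op V \<eta>) \<phi> \<and>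
     (\<forall>x\<in>\<Omega>. \<phi> (0, x) = \<phi>0 x) \<and>
     (\<forall>t\<ge>0. \<forall>x\<in>frontier \<Omega>. \<phi> (t, x) = 0)"

end

theory Submission
  imports Defs
begin

text \<open>Write the equation as \<open>\<phi>\<^sub>t + h t x \<phi> (\<nabla>\<phi>) = 0\<close>. The function \<open>h\<close> is Lipschitz in the value
  of \<open>\<phi>\<close>, and in \<open>x\<close> with constant \<open>L \<bar>p\<bar>\<close>, so doubling of variables yields a comparison
  principle. Moreover \<open>h\<close> is odd in the pair (value, gradient): \<open>u\<close> is a supersolution iff \<open>- u\<close> is
  a subsolution, and only subsolutions have to be studied. Since \<open>\<bar>h t x u p - V t x \<bullet> p\<bar> \<le> L \<bar>u\<bar>\<close>,
  transporting the initial value along the flow and damping its positive part by \<open>exp (- L t)\<close> while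
  amplifying its negative part by \<open>exp (L t)\<close> gives a subsolution, and dually a supersolution. Both
  are continuous and agree at time \<open>0\<close> and, by Nagumo's invariance theorem, on \<open>\<partial>\<Omega>\<close>. Truncated by the
  constants \<open>\<plusminus> max \<bar>\<phi>0\<bar>\<close>, which keeps them bounded in time, they serve as barriers for Perron's
  method; they also determine the sign of the solution.\<close>

section \<open>Upper semicontinuous functions and comparison\<close>

text \<open>In the level set equation \<open>h t x u p\<close> is \<open>V\<close> at the point
  \<open>x\<close> displaced by \<open>- (u / (|p|^2 + \<eta>)) p\<close>, multiplied by
  \<open>p\<close>. The displacement contains the product of value and gradient, hence oddness; its
  length times |p| is at most |u|, hence a Lipschitz constant in the value that is uniform in
  \<open>p\<close>. The cut-off keeps the denominator positive at p = 0, and its nonnegativity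
  preserves that bound. The equation is not monotone in the value, so comparison works with the
  weight \<open>exp (- l t)\<close>, l = L + 1. Time runs over a half-line and \<open>V\<close> may
  grow with it; boundedness of the solutions takes the place of a terminal time, since a positive
  weighted maximum must then be attained at a finite time. The boundary of \<Omega> may be rough, so
  boundary values cannot come from barriers built on its geometry. They come from the invariance of
  the frontier, which makes both transported functions vanish there. Perron's supremum is a priori
  only semicontinuous; its continuity results from comparing it with its own lower envelope.\<close>

definition usc_on :: "'a::metric_space set \<Rightarrow> ('a \<Rightarrow> real) \<Rightarrow> bool" where
  "usc_on E f \<longleftrightarrow> (\<forall>z\<in>E. \<forall>c>f z. \<exists>e>0. \<forall>y\<in>E \<inter> ball z e. f y < c)"

lemma usc_onD:
  assumes "usc_on E f" "z \<in> E" "f z < c"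
  obtains e where "e > 0" "\<And>y. y \<in> E \<Longrightarrow> dist z y < e \<Longrightarrow> f y < c"
  using assms unfolding usc_on_def by (metis IntI mem_ball)

lemma usc_on_less_near:
  assumes "usc_on E f" "z \<in> E" "f z < c"
  shows "\<exists>e>0. \<forall>y\<in>E. dist z y < e \<longrightarrow> f y < c"
  by (rule usc_onD[OF assms]) (intro exI conjI ballI impI)

lemma continuous_on_imp_usc_on:
  assumes "continuous_on E f"
  shows "usc_on E f"
  unfolding usc_on_def
proof (intro ballI allI impI)
  fix z c assume z: "z \<in> E" and c: "f z < c"
  then obtain d where d: "d > 0" "\<And>y. y \<in> E \<Longrightarrow> dist y z < d \<Longrightarrow> dist (f y) (f z) < c - f z"
    using assms unfolding continuous_on_iff by (metis diff_gt_0_iff_gt)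
  have "f y < c" if "y \<in> E \<inter> ball z d" for y
    using d(2)[of y] that by (auto simp: dist_real_def dist_commute)
  with d(1) show "\<exists>e>0. \<forall>y\<in>E \<inter> ball z e. f y < c" by blast
qed

lemma usc_on_add:
  assumes "usc_on E f" "usc_on E g"
  shows "usc_on E (\<lambda>z. f z + g z)"
  unfolding usc_on_def
proof (intro ballI allI impI)
  fix z c assume z: "z \<in> E" and c: "f z + g z < c"
  define d where "d = (c - f z - g z) / 2"
  have d: "d > 0" using c by (simp add: d_def)
  obtain e1 where e1: "e1 > 0" "\<And>y. y \<in> E \<Longrightarrow> dist z y < e1 \<Longrightarrow> f y < f z + d"
    using usc_onD[OF assms(1) z, of "f z + d"] d by auto
  obtain e2 where e2: "e2 > 0" "\<And>y. y \<in> E \<Longrightarrow> dist z y < e2 \<Longrightarrow> g y < g z + d"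
    using usc_onD[OF assms(2) z, of "g z + d"] d by auto
  have "f y + g y < c" if "y \<in> E \<inter> ball z (min e1 e2)" for y
    using e1(2)[of y] e2(2)[of y] that by (auto simp: d_def field_simps)
  with e1(1) e2(1) show "\<exists>e>0. \<forall>y\<in>E \<inter> ball z e. f y + g y < c"
    by (metis min_less_iff_conj)
qed

lemma usc_on_compose:
  assumes "usc_on E f" "continuous_on A g" "g ` A \<subseteq> E"
  shows "usc_on A (\<lambda>z. f (g z))"
  unfolding usc_on_def
proof (intro ballI allI impI)
  fix z c assume z: "z \<in> A" and c: "f (g z) < c"
  obtain e where e: "e > 0" "\<And>y. y \<in> E \<Longrightarrow> dist (g z) y < e \<Longrightarrow> f y < c"
    using usc_onD[OF assms(1) _ c] assms(3) z by blast
  obtain d where d: "d > 0" "\<And>y. y \<in> A \<Longrightarrow> dist y z < d \<Longrightarrow> dist (g y) (g z) < e"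
    using assms(2) z e(1) unfolding continuous_on_iff by metis
  have "f (g y) < c" if "y \<in> A \<inter> ball z d" for y
    using e(2)[of "g y"] d(2)[of y] that assms(3) by (auto simp: dist_commute)
  with d(1) show "\<exists>e>0. \<forall>y\<in>A \<inter> ball z e. f (g y) < c" by blast
qed

lemma usc_on_subset: "usc_on E f \<Longrightarrow> A \<subseteq> E \<Longrightarrow> usc_on A f"
  using usc_on_compose[of E f A "\<lambda>x. x"] by (simp add: continuous_on_id)

lemma usc_on_cong: "(\<And>z. z \<in> E \<Longrightarrow> f z = g z) \<Longrightarrow> usc_on E f \<longleftrightarrow> usc_on E g"
  unfolding usc_on_def by simp

text \<open>Without a maximum every \<open>z\<close> has some \<open>Y z\<close> of larger value,
  and \<open>f\<close> stays below \<open>f (Y z)\<close> near \<open>z\<close>. Of finitely many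
  such neighbourhoods covering \<open>K\<close>, the best of the points \<open>Y z\<close> lies in
  one of them and is therefore beaten by another.\<close>

lemma usc_on_attains_max:
  assumes "compact K" "K \<noteq> {}" "usc_on K f"
  obtains z where "z \<in> K" "\<And>y. y \<in> K \<Longrightarrow> f y \<le> f z"
proof (rule ccontr)
  assume "\<not> thesis"
  with that have "\<forall>z\<in>K. \<exists>y\<in>K. f z < f y" by (metis not_less)
  then obtain Y where Y: "\<And>z. z \<in> K \<Longrightarrow> Y z \<in> K \<and> f z < f (Y z)" by metis
  then have "\<forall>z\<in>K. \<exists>e>0. \<forall>y\<in>K. dist z y < e \<longrightarrow> f y < f (Y z)"
    by (metis usc_onD[OF assms(3)])
  then obtain e where e: "\<And>z. z \<in> K \<Longrightarrow> e z > 0"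
      "\<And>z y. z \<in> K \<Longrightarrow> y \<in> K \<Longrightarrow> dist z y < e z \<Longrightarrow> f y < f (Y z)"
    by metis
  have "K \<subseteq> (\<Union>z\<in>K. ball z (e z))" using e(1) by (auto intro: bexI)
  then obtain D where D: "D \<subseteq> K" "finite D" "K \<subseteq> (\<Union>z\<in>D. ball z (e z))"
    using compactE_image[OF assms(1), of K "\<lambda>z. ball z (e z)"] by auto
  have "D \<noteq> {}" using D(3) assms(2) by auto
  then have "Max (f ` Y ` D) \<in> f ` Y ` D" using D(2) by (intro Max_in) auto
  then obtain z where z: "z \<in> D" "f (Y z) = Max (f ` Y ` D)" by auto
  then obtain z' where z': "z' \<in> D" "dist z' (Y z) < e z'"
    using D Y[of z] by (auto simp: subset_iff)
  have "f (Y z) < f (Y z')" using e(2)[of z' "Y z"] z' z(1) D(1) Y by blast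
  moreover have "f (Y z') \<le> f (Y z)" using z'(1) z(2) D(2) by simp
  ultimately show False by simp
qed

text \<open>A Lebesgue number argument. It replaces the usual passage to the limit of vanishing
  penalisation: a strict bound on the diagonal already holds for all sufficiently close pairs, so
  one fixed choice of the parameters suffices.\<close>

lemma usc_on_near_diagonal:
  fixes F :: "'a::metric_space \<times> 'a \<Rightarrow> real"
  assumes "usc_on (C \<times> C) F" "compact D" "D \<subseteq> C" "\<And>z. z \<in> D \<Longrightarrow> F (z, z) < c"
  obtains \<rho> where "\<rho> > 0"
    "\<And>a b. a \<in> C \<Longrightarrow> b \<in> C \<Longrightarrow> a \<in> D \<or> b \<in> D \<Longrightarrow> dist a b < \<rho> \<Longrightarrow> F (a, b) < c"
proof -
  have "\<forall>z\<in>D. \<exists>e>0. \<forall>y\<in>C \<times> C. dist (z, z) y < e \<longrightarrow> F y < c"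
  proof
    fix z assume z: "z \<in> D"
    then have "(z, z) \<in> C \<times> C" using assms(3) by auto
    show "\<exists>e>0. \<forall>y\<in>C \<times> C. dist (z, z) y < e \<longrightarrow> F y < c"
      by (rule usc_onD[OF assms(1) \<open>(z, z) \<in> C \<times> C\<close> assms(4)[OF z]]) (intro exI conjI ballI impI)
  qed
  then obtain e where e: "\<And>z. z \<in> D \<Longrightarrow> e z > 0"
      "\<And>z y. z \<in> D \<Longrightarrow> y \<in> C \<times> C \<Longrightarrow> dist (z, z) y < e z \<Longrightarrow> F y < c"
    by metis
  have "D \<subseteq> \<Union> ((\<lambda>z. ball z (e z / 2)) ` D)" using e(1) by (auto intro: bexI)
  then obtain \<rho> where \<rho>: "\<rho> > 0" "\<forall>x\<in>D. \<exists>G\<in>(\<lambda>z. ball z (e z / 2)) ` D. ball x \<rho> \<subseteq> G"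
    using Heine_Borel_lemma[OF assms(2)] by (metis (no_types, lifting) imageE open_ball)
  have "F (a, b) < c" if ab: "a \<in> C" "b \<in> C" "dist a b < \<rho>" "x \<in> D" "x = a \<or> x = b" for a b x
  proof -
    obtain z where z: "z \<in> D" "ball x \<rho> \<subseteq> ball z (e z / 2)" using \<rho>(2) ab(4) by blast
    have "a \<in> ball x \<rho>" "b \<in> ball x \<rho>" using ab \<rho>(1) by (auto simp: dist_commute)
    then have "dist z a < e z / 2" "dist z b < e z / 2" using z(2) by auto
    then have "dist (z, z) (a, b) < e z"
      unfolding dist_Pair_Pair using sqrt_sum_squares_le_sum[of "dist z a" "dist z b"] by simp
    then show ?thesis using e(2)[OF z(1)] ab by auto
  qed
  then show ?thesis using that[OF \<rho>(1)] by blast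
qed

text \<open>The subsolution test alone, without envelope or boundedness, and with the gradient field
  of the test function explicit. Perron's method applies it to functions that are merely upper
  semicontinuous.\<close>

definition visc_sub :: "'a::euclidean_space set \<Rightarrow> ('a \<Rightarrow> real \<Rightarrow> 'a \<Rightarrow> real) \<Rightarrow> ('a \<Rightarrow> real) \<Rightarrow> bool" where
  "visc_sub Q H u \<longleftrightarrow>
     (\<forall>\<phi> G z. (\<forall>y\<in>Q. GDERIV \<phi> y :> G y) \<and> continuous_on Q G \<and> z \<in> Q \<and>
        local_max_at Q (\<lambda>y. u y - \<phi> y) z \<longrightarrow> H z (u z) (G z) \<le> 0)"

lemma visc_subD:
  assumes "visc_sub Q H u" "\<And>y. y \<in> Q \<Longrightarrow> GDERIV \<phi> y :> G y" "continuous_on Q G" "z \<in> Q"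
    "e > 0" "\<And>y. y \<in> Q \<Longrightarrow> dist z y < e \<Longrightarrow> u y - \<phi> y \<le> u z - \<phi> z"
  shows "H z (u z) (G z) \<le> 0"
proof -
  have "local_max_at Q (\<lambda>y. u y - \<phi> y) z"
    unfolding local_max_at_def using assms(5,6) by auto
  then show ?thesis using assms unfolding visc_sub_def by blast
qed

text \<open>With penalty parameter r^2 / (32 M) the bound 2 M on the penalty yields a^2 <= r^2 / 8,
  which is just enough to stay below r / 2.\<close>

lemma penalty_bound:
  fixes a r M :: real
  assumes "a\<^sup>2 / (2 * (r\<^sup>2 / (32 * M))) \<le> 2 * M" "M > 0" "r > 0" "a \<ge> 0"
  shows "a < r / 2"
proof -
  have "a\<^sup>2 / (2 * (r\<^sup>2 / (32 * M))) = 16 * M * (a / r)\<^sup>2"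
    using assms(2,3) by (simp add: field_simps power_divide)
  then have "M * (8 * (a / r)\<^sup>2) \<le> M * 1" using assms(1) by simp
  then have "8 * (a / r)\<^sup>2 \<le> 1" using assms(2) by (rule mult_left_le_imp_le)
  then have "(a / r)\<^sup>2 < (1 / 2)\<^sup>2" by (simp add: power2_eq_square)
  then have "a / r < 1 / 2" by (rule power2_less_imp_less) simp
  then show ?thesis using assms(3) by (simp add: field_simps)
qed

text \<open>The case \<open>K = 0\<close> drops the exponential and serves the second of the doubled
  variables.\<close>

lemma GDERIV_penalty:
  fixes y :: "'a::euclidean_space" and q :: "real \<times> 'a" and s :: real
  assumes "\<epsilon> \<noteq> 0" "\<delta> \<noteq> 0"
  shows "GDERIV (\<lambda>q. K * exp (l * fst q) +
           ((snd q - y) \<bullet> (snd q - y) / (2 * \<epsilon>) + (fst q - s) * (fst q - s) / (2 * \<delta>))) q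
         :> (l * K * exp (l * fst q) + (fst q - s) / \<delta>, (snd q - y) /\<^sub>R \<epsilon>)"
proof -
  have fs: "(fst has_derivative fst) (at q)" "(snd has_derivative snd) (at q)"
    by (rule has_derivative_fst[OF has_derivative_ident] has_derivative_snd[OF has_derivative_ident])+
  have 1: "((\<lambda>q. K * exp (l * fst q)) has_derivative (\<lambda>v. K * (exp (l * fst q) * (l * fst v)))) (at q)"
    by (rule derivative_eq_intros fs refl)+ (simp add: fun_eq_iff)
  have 2: "((\<lambda>q. (snd q - y) \<bullet> (snd q - y) / (2 * \<epsilon>)) has_derivative
      (\<lambda>v. ((snd q - y) \<bullet> (snd v - 0) + (snd v - 0) \<bullet> (snd q - y)) / (2 * \<epsilon>))) (at q)"
    by (intro bounded_linear.has_derivative[OF bounded_linear_divide] has_derivative_inner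
        has_derivative_diff fs has_derivative_const)
  have 3: "((\<lambda>q. (fst q - s) * (fst q - s) / (2 * \<delta>)) has_derivative
      (\<lambda>v. ((fst q - s) * (fst v - 0) + (fst v - 0) * (fst q - s)) / (2 * \<delta>))) (at q)"
    by (intro bounded_linear.has_derivative[OF bounded_linear_divide] has_derivative_mult
        has_derivative_diff fs has_derivative_const)
  have "K * (exp (l * fst q) * (l * fst v)) + (((snd q - y) \<bullet> (snd v - 0) + (snd v - 0) \<bullet> (snd q - y)) / (2 * \<epsilon>) +
      ((fst q - s) * (fst v - 0) + (fst v - 0) * (fst q - s)) / (2 * \<delta>)) =
      v \<bullet> (l * K * exp (l * fst q) + (fst q - s) / \<delta>, (snd q - y) /\<^sub>R \<epsilon>)" for v
  proof -
    define X where "X = (snd q - y) \<bullet> snd v"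
    have "(snd q - y) \<bullet> (snd v - 0) = X" "(snd v - 0) \<bullet> (snd q - y) = X"
        "snd v \<bullet> ((snd q - y) /\<^sub>R \<epsilon>) = X / \<epsilon>"
      by (simp_all only: X_def inner_commute diff_zero inner_scaleR_right) (simp add: divide_inverse)
    then show ?thesis
      unfolding inner_prod_def fst_conv snd_conv using assms by (simp add: field_simps)
  qed
  then show ?thesis
    unfolding gderiv_def
    by (intro has_derivative_eq_rhs[OF has_derivative_add[OF 1 has_derivative_add[OF 2 3]]] ext) simp
qed

section \<open>Comparison principle by doubling of variables\<close>

locale hamiltonian =
  fixes h :: "real \<Rightarrow> 'a::euclidean_space \<Rightarrow> real \<Rightarrow> 'a \<Rightarrow> real" and L :: real and \<Omega> :: "'a set"
  assumes h_cont: "continuous_on ({0..} \<times> UNIV) (\<lambda>(t, x, u, p). h t x u p)"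
    and h_lip: "t \<ge> 0 \<Longrightarrow> \<bar>h t x a p - h t y b p\<bar> \<le> L * (norm (x - y) * norm p + \<bar>a - b\<bar>)"
    and h_odd: "t \<ge> 0 \<Longrightarrow> h t x (- a) (- p) = - h t x a p"
    and L_nonneg: "L \<ge> 0"
    and open_dom: "open \<Omega>" and bounded_dom: "bounded \<Omega>"
begin

definition H :: "real \<times> 'a \<Rightarrow> real \<Rightarrow> real \<times> 'a \<Rightarrow> real" where
  "H = (\<lambda>(t, x) u (p\<^sub>t, p). p\<^sub>t + h t x u p)"

abbreviation Q where "Q \<equiv> {0::real<..} \<times> \<Omega>"
abbreviation E where "E \<equiv> {0::real..} \<times> closure \<Omega>"

lemma H_odd: "z \<in> Q \<Longrightarrow> H z (- a) (- q) = - H z a q"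
  by (cases z; cases q) (auto simp: H_def h_odd)

lemma open_Q: "open Q"
  by (intro open_Times open_dom open_greaterThan)

lemma continuous_on_H: "continuous_on (Q \<times> UNIV \<times> UNIV) (\<lambda>(z, a, q). H z a q)"
proof -
  have "continuous_on (Q \<times> UNIV \<times> UNIV)
    (\<lambda>w. fst (snd (snd w)) + (\<lambda>(t, x, u, p). h t x u p) (fst (fst w), snd (fst w), fst (snd w), snd (snd (snd w))))"
    by (intro continuous_intros continuous_on_compose2[OF h_cont]) auto
  then show ?thesis by (auto simp: H_def case_prod_beta)
qed

text \<open>By oddness \<open>w\<close> stands for the negative of a supersolution. If the sum were
  positive somewhere, its maximum \<open>K\<close> after weighting with \<open>exp (- l * t)\<close>
  would be positive. At a maximum of the doubled, penalised function the two tests combine to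
  \<open>l * K * exp (l * t) \<le> L * K * exp (l * t)\<close> up to multiples of
  \<open>\<kappa>\<close>, against \<open>l = L + 1\<close>.\<close>

proposition comparison:
  assumes usc: "usc_on E u" "usc_on E w"
    and bound: "\<And>z. z \<in> E \<Longrightarrow> u z \<le> M" "\<And>z. z \<in> E \<Longrightarrow> w z \<le> M"
    and bdry: "\<And>z. z \<in> E - Q \<Longrightarrow> u z + w z \<le> 0"
    and sub: "visc_sub Q H u" "visc_sub Q H w"
    and "z \<in> E"
  shows "u z + w z \<le> 0"
proof (rule ccontr)
  assume neg: "\<not> u z + w z \<le> 0"
  obtain t\<^sub>1 x\<^sub>1 where z1: "z = (t\<^sub>1, x\<^sub>1)" by force
  have tx1: "t\<^sub>1 \<ge> 0" "x\<^sub>1 \<in> closure \<Omega>" using \<open>z \<in> E\<close> z1 by auto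
  define l where "l = L + 1"
  have l: "l \<ge> 1" using L_nonneg by (simp add: l_def)
  have M: "M > 0" using bound[OF \<open>z \<in> E\<close>] neg by linarith
  define F where "F = (\<lambda>y::real \<times> 'a. (u y + w y) * exp (- l * fst y))"
  have Fz: "F z > 0" using neg by (simp add: F_def)
  have usc_uw: "usc_on E (\<lambda>y. u y + w y)" by (intro usc_on_add usc)
  have usc_F: "usc_on E F"
    unfolding usc_on_def
  proof (intro ballI allI impI)
    fix y c assume y: "y \<in> E" and c: "F y < c"
    have iff: "F y < c \<longleftrightarrow> u y + w y + (- c * exp (l * fst y)) < 0" for y
      by (simp add: F_def exp_minus field_simps)
    have "usc_on E (\<lambda>y. u y + w y + (- c * exp (l * fst y)))"
      by (intro usc_on_add[OF usc_uw] continuous_on_imp_usc_on continuous_intros)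
    from usc_onD[OF this y] c iff
    obtain e where "e > 0" "\<And>y'. y' \<in> E \<Longrightarrow> dist y y' < e \<Longrightarrow> F y' < c" by metis
    then show "\<exists>e>0. \<forall>y'\<in>E \<inter> ball y e. F y' < c" by auto
  qed
  \<comment> \<open>Beyond this time the bound \<open>2 * M\<close> on the sum pushes
    \<open>F\<close> below \<open>F z\<close>, so a maximum over \<open>{0..T}\<close> is one over
    all times. The estimate rests on \<open>T < exp (l * T)\<close>.\<close>
  define T where "T = max t\<^sub>1 (2 * M / F z)"
  have T: "T \<ge> t\<^sub>1" "T \<ge> 0" using tx1 by (auto simp: T_def)
  have eT: "2 * M < F z * exp (l * T)"
  proof -
    have "2 * M / F z \<le> T" by (simp add: T_def)
    also have "T < exp (l * T)"
      using exp_ge_add_one_self[of "l * T"] mult_right_mono[OF l T(2)] by linarith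
    finally show ?thesis using Fz by (simp add: field_simps)
  qed
  have cpt: "compact ({0..s} \<times> closure \<Omega>)" for s :: real
    by (intro compact_Times) (use bounded_dom in auto)
  obtain z\<^sub>0 where z0: "z\<^sub>0 \<in> {0..T} \<times> closure \<Omega>" "\<And>y. y \<in> {0..T} \<times> closure \<Omega> \<Longrightarrow> F y \<le> F z\<^sub>0"
  proof (rule usc_on_attains_max[OF cpt, of T F])
    show "{0..T} \<times> closure \<Omega> \<noteq> {}" using tx1 T by auto
    show "usc_on ({0..T} \<times> closure \<Omega>) F" by (rule usc_on_subset[OF usc_F]) auto
  qed (use that in blast)
  define K where "K = F z\<^sub>0"
  have Kz: "F z \<le> K" using z0(2)[of z] tx1 T z1 by (auto simp: K_def)
  have K: "K > 0" using Kz Fz by linarith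
  have KT: "2 * M < K * exp (l * T)"
    using eT Kz by (meson exp_ge_zero less_le_trans mult_right_mono)
  have le_K: "u y + w y \<le> K * exp (l * fst y)" if y: "y \<in> E" for y
  proof (cases "fst y \<le> T")
    case True
    then have "F y \<le> K" using z0(2)[of y] y by (auto simp: K_def mem_Times_iff)
    then show ?thesis by (simp add: F_def exp_minus field_simps)
  next
    case False
    then have "exp (l * T) \<le> exp (l * fst y)" using l by simp
    then show ?thesis using KT bound[OF y] mult_left_mono[of "exp (l * T)" "exp (l * fst y)" K] K
      by linarith
  qed
  \<comment> \<open>One unit of time beyond \<open>T\<close>: the maximum will turn out to have
    \<open>t < T\<close> and \<open>s < T + 1\<close>, so the closing time of the slab never meets
    the tests and only \<open>B\<close> acts as boundary.\<close>
  define C where "C = {0..T + 1} \<times> closure \<Omega>"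
  have C: "compact C" "C \<subseteq> E" using cpt by (auto simp: C_def)
  have usc_C: "usc_on (C \<times> C) (\<lambda>y. u (fst y) + w (snd y))"
    by (intro usc_on_add usc_on_compose[OF usc(1)] usc_on_compose[OF usc(2)] continuous_intros)
      (use C in auto)
  \<comment> \<open>Tolerance for the penalties and for the oscillation of \<open>h\<close> in time.
    The final estimate leads to \<open>K \<le> (3 * L + 1) * \<kappa>\<close>; half the critical
    value excludes it.\<close>
  define \<kappa> where "\<kappa> = K / (2 * (3 * L + 1))"
  have \<kappa>: "\<kappa> > 0" "(3 * L + 1) * \<kappa> < K"
  proof -
    define c where "c = 3 * L + 1"
    have "c > 0" using L_nonneg by (simp add: c_def)
    then have "\<kappa> > 0" "c * \<kappa> < K" using K by (simp_all add: \<kappa>_def flip: c_def)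
    then show "\<kappa> > 0" "(3 * L + 1) * \<kappa> < K" by (simp_all add: c_def)
  qed
  obtain \<rho>1 where r1: "\<rho>1 > 0" "\<And>a b. a \<in> C \<Longrightarrow> b \<in> C \<Longrightarrow> dist a b < \<rho>1 \<Longrightarrow>
      u a + w b + - K * exp (l * fst a) < \<kappa>"
  proof -
    have "usc_on (C \<times> C) (\<lambda>y. u (fst y) + w (snd y) + (- K * exp (l * fst (fst y))))"
      by (intro usc_on_add[OF usc_C] continuous_on_imp_usc_on continuous_intros)
    then show ?thesis
    proof (rule usc_on_near_diagonal[OF _ C(1) order_refl, of _ \<kappa>])
      show "u (fst (y, y)) + w (snd (y, y)) + - K * exp (l * fst (fst (y, y))) < \<kappa>" if "y \<in> C" for y
      proof -
        have "u y + w y \<le> K * exp (l * fst y)" using le_K that C(2) by blast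
        then show ?thesis using \<kappa>(1) by simp
      qed
    next
      fix \<rho> assume "\<rho> > 0" and *: "\<And>a b. a \<in> C \<Longrightarrow> b \<in> C \<Longrightarrow> a \<in> C \<or> b \<in> C \<Longrightarrow> dist a b < \<rho> \<Longrightarrow>
        u (fst (a, b)) + w (snd (a, b)) + - K * exp (l * fst (fst (a, b))) < \<kappa>"
      then show ?thesis using that[OF \<open>\<rho> > 0\<close>] *[unfolded fst_conv snd_conv] by blast
    qed
  qed
  define B where "B = {0} \<times> closure \<Omega> \<union> {0..T + 1} \<times> frontier \<Omega>"
  have B: "compact B" "B \<subseteq> C" "B \<subseteq> E - Q" "C - Q \<subseteq> B"
  proof -
    show "compact B" unfolding B_def
      by (intro compact_Un compact_Times) (use bounded_dom compact_frontier_bounded in auto)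
    show "B \<subseteq> C" "B \<subseteq> E - Q" "C - Q \<subseteq> B"
      using T open_dom by (auto simp: B_def C_def frontier_def interior_open)
  qed
  obtain \<rho>2 where r2: "\<rho>2 > 0" "\<And>a b. a \<in> C \<Longrightarrow> b \<in> C \<Longrightarrow> a \<in> B \<or> b \<in> B \<Longrightarrow> dist a b < \<rho>2 \<Longrightarrow>
      u a + w b < K"
  proof (rule usc_on_near_diagonal[OF usc_C B(1,2)])
    show "u (fst (y, y)) + w (snd (y, y)) < K" if "y \<in> B" for y
      using bdry[of y] that B K by force
  next
    fix \<rho> assume "\<rho> > 0" and *: "\<And>a b. a \<in> C \<Longrightarrow> b \<in> C \<Longrightarrow> a \<in> B \<or> b \<in> B \<Longrightarrow> dist a b < \<rho> \<Longrightarrow>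
      u (fst (a, b)) + w (snd (a, b)) < K"
    then show ?thesis using that[OF \<open>\<rho> > 0\<close>] *[unfolded fst_conv snd_conv] by blast
  qed
  obtain R where R: "R > 0" "\<And>x. x \<in> closure \<Omega> \<Longrightarrow> norm x \<le> R"
    using bounded_closure[OF bounded_dom] unfolding bounded_pos by blast
  define \<rho> where "\<rho> = min 1 (min \<rho>1 \<rho>2)"
  have \<rho>: "\<rho> > 0" "\<rho> \<le> 1" "\<rho> \<le> \<rho>1" "\<rho> \<le> \<rho>2" using r1 r2 by (auto simp: \<rho>_def)
  define \<epsilon> where "\<epsilon> = \<rho>\<^sup>2 / (32 * M)"
  have \<epsilon>: "\<epsilon> > 0" using \<rho> M by (simp add: \<epsilon>_def)
  \<comment> \<open>A bound for the gradient \<open>(x - y) / \<epsilon>\<close>. Since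
    \<open>h\<close> is merely continuous in time, its modulus of continuity is taken on a compact
    set depending on \<open>P\<close>, and thus on \<open>\<epsilon>\<close>; the time penalty
    \<open>\<delta>\<close> has to be chosen afterwards.\<close>
  define P where "P = 2 * R / \<epsilon>"
  define S where "S = {0..T + 1} \<times> closure \<Omega> \<times> {- M..M} \<times> cball (0::'a) P"
  have "compact S" unfolding S_def
    by (intro compact_Times) (use bounded_dom in auto)
  then have "uniformly_continuous_on S (\<lambda>(t, x, u, p). h t x u p)"
    by (intro compact_uniformly_continuous continuous_on_subset[OF h_cont]) (auto simp: S_def)
  then obtain \<mu> where \<mu>: "\<mu> > 0" "\<And>a b. a \<in> S \<Longrightarrow> b \<in> S \<Longrightarrow> dist a b < \<mu> \<Longrightarrow>
      dist ((\<lambda>(t, x, u, p). h t x u p) a) ((\<lambda>(t, x, u, p). h t x u p) b) < \<kappa>"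
    unfolding uniformly_continuous_on_def using \<kappa>(1) by metis
  define \<delta> where "\<delta> = (min \<rho> \<mu>)\<^sup>2 / (32 * M)"
  have \<delta>: "\<delta> > 0" using \<rho> \<mu> M by (simp add: \<delta>_def)
  define \<Phi> where "\<Phi> = (\<lambda>y. u (fst y) + w (snd y) + (- K * exp (l * fst (fst y))
     - (norm (snd (fst y) - snd (snd y)))\<^sup>2 / (2 * \<epsilon>) - (fst (fst y) - fst (snd y))\<^sup>2 / (2 * \<delta>)))"
  have "usc_on (C \<times> C) \<Phi>"
    unfolding \<Phi>_def
    by (intro usc_on_add[OF usc_C] continuous_on_imp_usc_on continuous_intros) (use \<epsilon> \<delta> in auto)
  moreover have "z\<^sub>0 \<in> C" using z0 by (auto simp: C_def)
  ultimately obtain m where m: "m \<in> C \<times> C" "\<And>y. y \<in> C \<times> C \<Longrightarrow> \<Phi> y \<le> \<Phi> m"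
    using usc_on_attains_max[of "C \<times> C" \<Phi>] C(1) compact_Times by blast
  obtain t x s y where m_eq: "m = ((t, x), (s, y))" by (metis surj_pair)
  have mem: "(t, x) \<in> C" "(s, y) \<in> C" using m m_eq by auto
  \<comment> \<open>At the undoubled maximum the penalties vanish. Hence at \<open>m\<close> both
    penalties together with \<open>K * exp (l * t)\<close> are at most \<open>d\<close>.\<close>
  have "\<Phi> (z\<^sub>0, z\<^sub>0) = 0" by (simp add: \<Phi>_def K_def F_def flip: exp_add)
  then have \<Phi>m: "0 \<le> \<Phi> m" using m(2)[of "(z\<^sub>0, z\<^sub>0)"] \<open>z\<^sub>0 \<in> C\<close> by auto
  define d where "d = u (t, x) + w (s, y)"
  have pen: "K * exp (l * t) + (norm (x - y))\<^sup>2 / (2 * \<epsilon>) + (t - s)\<^sup>2 / (2 * \<delta>) \<le> d"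
    using \<Phi>m by (simp add: \<Phi>_def m_eq d_def)
  have nn: "0 \<le> (norm (x - y))\<^sup>2 / (2 * \<epsilon>)" "0 \<le> (t - s)\<^sup>2 / (2 * \<delta>)" using \<epsilon> \<delta> by auto
  have memE: "(t, x) \<in> E" "(s, y) \<in> E" using mem C(2) by auto
  have d2M: "d \<le> 2 * M" using bound(1)[OF memE(1)] bound(2)[OF memE(2)] by (simp add: d_def)
  have "0 < K * exp (l * t)" using K by simp
  have "(norm (x - y))\<^sup>2 / (2 * \<epsilon>) \<le> 2 * M" using pen nn d2M \<open>0 < K * exp (l * t)\<close> by linarith
  then have xy: "norm (x - y) < \<rho> / 2" unfolding \<epsilon>_def by (rule penalty_bound[OF _ M \<rho>(1) norm_ge_zero])
  have "(t - s)\<^sup>2 / (2 * \<delta>) \<le> 2 * M" using pen nn d2M \<open>0 < K * exp (l * t)\<close> by linarith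
  then have "\<bar>t - s\<bar>\<^sup>2 / (2 * \<delta>) \<le> 2 * M" by simp
  then have ts: "\<bar>t - s\<bar> < min \<rho> \<mu> / 2" unfolding \<delta>_def
    by (rule penalty_bound[OF _ M]) (use \<rho>(1) \<mu>(1) in auto)
  have "dist (t, x) (s, y) \<le> \<bar>t - s\<bar> + norm (x - y)"
    using sqrt_sum_squares_le_sum[of "\<bar>t - s\<bar>" "norm (x - y)"]
    by (simp add: dist_Pair_Pair dist_real_def dist_norm[of x y])
  then have dist: "dist (t, x) (s, y) < \<rho>" using xy ts \<rho>(1) by linarith
  have d_up: "d - K * exp (l * t) < \<kappa>" using r1(2)[OF mem] dist \<rho> by (simp add: d_def)
  have "t \<ge> 0" "s \<ge> 0" using memE by auto
  then have "1 \<le> exp (l * t)" using l by simp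
  then have dK: "K \<le> K * exp (l * t)" using K by simp
  \<comment> \<open>Close pairs meeting \<open>B\<close> have sum below \<open>K\<close>, whereas
    the maximum point has \<open>d \<ge> K\<close>; so both of its components lie in the open
    domain.\<close>
  then have "\<not> d < K" using pen nn by linarith
  then have "(t, x) \<notin> B" "(s, y) \<notin> B" using r2(2)[OF mem] dist \<rho> by (auto simp: d_def)
  then have inQ: "(t, x) \<in> Q" "(s, y) \<in> Q" using mem B(4) by auto
  have "K * exp (l * t) < K * exp (l * T)" using pen nn d2M KT by linarith
  then have tT: "t < T" using K l by (simp)
  then have sT: "s < T + 1" using ts \<rho> by linarith
  define p where "p = (x - y) /\<^sub>R \<epsilon>"
  have norm_p: "norm p = norm (x - y) / \<epsilon>" using \<epsilon> by (simp add: p_def divide_inverse mult.commute)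
  define a where "a = (t - s) / \<delta>"
  have "H (t, x) (u (t, x)) (l * K * exp (l * t) + a, p) \<le> 0"
  proof -
    define \<phi> where "\<phi> = (\<lambda>q::real \<times> 'a. K * exp (l * fst q) +
       ((snd q - y) \<bullet> (snd q - y) / (2 * \<epsilon>) + (fst q - s) * (fst q - s) / (2 * \<delta>)))"
    define G where "G = (\<lambda>q::real \<times> 'a. (l * K * exp (l * fst q) + (fst q - s) / \<delta>, (snd q - y) /\<^sub>R \<epsilon>))"
    have "H (t, x) (u (t, x)) (G (t, x)) \<le> 0"
    proof (rule visc_subD[OF sub(1), where \<phi> = \<phi>])
      show "GDERIV \<phi> q :> G q" for q
        using GDERIV_penalty[of \<epsilon> \<delta> K l y s q] \<epsilon> \<delta> by (simp add: \<phi>_def G_def)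
      show "continuous_on Q G" unfolding G_def by (intro continuous_intros) (use \<delta> in auto)
      show "0 < T + 1 - t" using tT by simp
      show "u q - \<phi> q \<le> u (t, x) - \<phi> (t, x)" if "q \<in> Q" "dist (t, x) q < T + 1 - t" for q
      proof -
        have "dist t (fst q) < T + 1 - t" using that(2) dist_fst_le[of "(t, x)" q] by simp
        then have "q \<in> C" using that closure_subset[of \<Omega>] by (auto simp: C_def dist_real_def)
        then have "\<Phi> (q, (s, y)) \<le> \<Phi> m" using m(2) mem by auto
        moreover have "\<Phi> (q, (s, y)) = u q + w (s, y) - \<phi> q" "\<Phi> m = u (t, x) + w (s, y) - \<phi> (t, x)"
          by (simp_all add: \<Phi>_def \<phi>_def m_eq dot_square_norm flip: power2_eq_square)
        ultimately show ?thesis by linarith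
      qed
    qed (use inQ in auto)
    then show ?thesis by (simp add: G_def a_def p_def)
  qed
  then have 1: "l * K * exp (l * t) + a + h t x (u (t, x)) p \<le> 0" by (simp add: H_def)
  have "H (s, y) (w (s, y)) (- a, - p) \<le> 0"
  proof -
    define \<phi> where "\<phi> = (\<lambda>q::real \<times> 'a.
       ((snd q - x) \<bullet> (snd q - x) / (2 * \<epsilon>) + (fst q - t) * (fst q - t) / (2 * \<delta>)))"
    define G where "G = (\<lambda>q::real \<times> 'a. ((fst q - t) / \<delta>, (snd q - x) /\<^sub>R \<epsilon>))"
    have "H (s, y) (w (s, y)) (G (s, y)) \<le> 0"
    proof (rule visc_subD[OF sub(2), where \<phi> = \<phi>])
      show "GDERIV \<phi> q :> G q" for q
        using GDERIV_penalty[of \<epsilon> \<delta> 0 l x t q] \<epsilon> \<delta> by (simp add: \<phi>_def G_def)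
      show "continuous_on Q G" unfolding G_def by (intro continuous_intros) (use \<delta> in auto)
      show "0 < T + 1 - s" using sT by simp
      show "w q - \<phi> q \<le> w (s, y) - \<phi> (s, y)" if "q \<in> Q" "dist (s, y) q < T + 1 - s" for q
      proof -
        have "dist s (fst q) < T + 1 - s" using that(2) dist_fst_le[of "(s, y)" q] by simp
        then have "q \<in> C" using that closure_subset[of \<Omega>] by (auto simp: C_def dist_real_def)
        then have "\<Phi> ((t, x), q) \<le> \<Phi> m" using m(2) mem by auto
        moreover have "\<Phi> ((t, x), q) = u (t, x) + w q - K * exp (l * t) - \<phi> q"
            "\<Phi> m = u (t, x) + w (s, y) - K * exp (l * t) - \<phi> (s, y)"
          by (simp_all add: \<Phi>_def \<phi>_def m_eq dot_square_norm norm_minus_commute power2_commute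
              flip: power2_eq_square)
        ultimately show ?thesis by linarith
      qed
    qed (use inQ in auto)
    moreover have "G (s, y) = (- a, - p)"
      using \<delta> by (simp add: G_def a_def p_def field_simps scaleR_diff_right)
    ultimately show ?thesis by simp
  qed
  then have "- a + h s y (- (- w (s, y))) (- p) \<le> 0" by (simp add: H_def)
  then have 2: "- a - h s y (- w (s, y)) p \<le> 0" using h_odd[OF \<open>s \<ge> 0\<close>, of y "- w (s, y)" p] by simp
  have "norm (x - y) \<le> 2 * R" using R(2)[of x] R(2)[of y] mem norm_triangle_ineq4[of x y]
    by (force simp: C_def)
  then have "norm p \<le> P" using \<epsilon> divide_right_mono[of _ _ \<epsilon>] by (simp add: norm_p P_def)
  moreover have "d \<ge> 0" using pen nn K dK by linarith
  then have "- w (s, y) \<le> M" "- M \<le> - w (s, y)"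
    using bound(1)[OF memE(1)] bound(2)[OF memE(2)] by (auto simp: d_def)
  ultimately have "(s, y, - w (s, y), p) \<in> S" "(t, y, - w (s, y), p) \<in> S"
    using mem by (auto simp: S_def C_def)
  moreover have "dist (s, y, - w (s, y), p) (t, y, - w (s, y), p) < \<mu>"
    using ts \<mu>(1) by (auto simp: dist_Pair_Pair dist_real_def abs_minus_commute)
  ultimately have 3: "h s y (- w (s, y)) p - h t y (- w (s, y)) p \<le> \<kappa>"
    using \<mu>(2)[of "(s, y, - w (s, y), p)" "(t, y, - w (s, y), p)"] by (simp add: dist_real_def)
  \<comment> \<open>The product that multiplies the Lipschitz constant in \<open>x\<close> is twice
    the space penalty, and the penalties are below \<open>\<kappa>\<close> by the near-diagonal
    bound.\<close>
  have "norm (x - y) * norm p = 2 * ((norm (x - y))\<^sup>2 / (2 * \<epsilon>))"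
    using \<epsilon> by (simp add: norm_p power2_eq_square)
  also have "\<dots> \<le> 2 * \<kappa>" using pen nn d_up by linarith
  finally have "norm (x - y) * norm p + \<bar>u (t, x) - - w (s, y)\<bar> \<le> 3 * \<kappa> + K * exp (l * t)"
    using d_up \<open>d \<ge> 0\<close> by (simp add: d_def)
  then have "\<bar>h t x (u (t, x)) p - h t y (- w (s, y)) p\<bar> \<le> L * (3 * \<kappa> + K * exp (l * t))"
    using h_lip[OF \<open>t \<ge> 0\<close>] mult_left_mono[OF _ L_nonneg] order_trans by meson
  then have "l * K * exp (l * t) \<le> \<kappa> + L * (3 * \<kappa> + K * exp (l * t))" using 1 2 3 by linarith
  then have "K * exp (l * t) \<le> (3 * L + 1) * \<kappa>" by (simp add: l_def algebra_simps)
  then show False using \<kappa>(2) dK by linarith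
qed

end

section \<open>Perron's method\<close>

text \<open>The upper envelope as an infimum of local upper bounds. For functions bounded above it
  is, at points of \<open>Q\<close>, the limit of suprema in \<open>usc_env\<close>, but handled
  without any convergence argument.\<close>

definition upper_env :: "'a::metric_space set \<Rightarrow> ('a \<Rightarrow> real) \<Rightarrow> 'a \<Rightarrow> real" where
  "upper_env Q u z = Inf {c. \<exists>r>0. \<forall>y\<in>Q. dist z y < r \<longrightarrow> u y \<le> c}"

context
  fixes Q :: "'a::metric_space set" and u :: "'a \<Rightarrow> real" and M :: real
  assumes bounded: "\<And>y. y \<in> Q \<Longrightarrow> u y \<le> M"
begin

lemma upper_env_ge: "u z \<le> upper_env Q u z" if "z \<in> Q"
  unfolding upper_env_def
proof (rule cInf_greatest)
  show "{c. \<exists>r>0. \<forall>y\<in>Q. dist z y < r \<longrightarrow> u y \<le> c} \<noteq> {}"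
    using bounded zero_less_one by blast
  show "u z \<le> c" if "c \<in> {c. \<exists>r>0. \<forall>y\<in>Q. dist z y < r \<longrightarrow> u y \<le> c}" for c
    using that \<open>z \<in> Q\<close> by auto
qed

lemma upper_env_le:
  assumes "z \<in> Q" "r > 0" "\<And>y. y \<in> Q \<Longrightarrow> dist z y < r \<Longrightarrow> u y \<le> c"
  shows "upper_env Q u z \<le> c"
  unfolding upper_env_def
proof (rule cInf_lower)
  show "c \<in> {c. \<exists>r>0. \<forall>y\<in>Q. dist z y < r \<longrightarrow> u y \<le> c}" using assms by blast
  show "bdd_below {c. \<exists>r>0. \<forall>y\<in>Q. dist z y < r \<longrightarrow> u y \<le> c}"
    by (rule bdd_belowI[of _ "u z"]) (use assms(1) in auto)
qed

lemma upper_env_near: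
  assumes "z \<in> Q" "r > 0" "c < upper_env Q u z"
  obtains y where "y \<in> Q" "dist z y < r" "c < u y"
proof (rule ccontr)
  note witness = that
  assume "\<not> thesis"
  then have "u y \<le> c" if "y \<in> Q" "dist z y < r" for y
    using witness[OF that] by linarith
  from upper_env_le[OF assms(1,2) this] assms(3) show False by simp
qed

lemma usc_on_upper_env: "usc_on Q (upper_env Q u)"
  unfolding usc_on_def
proof (intro ballI allI impI)
  fix z c assume z: "z \<in> Q" and c: "upper_env Q u z < c"
  have "{c. \<exists>r>0. \<forall>y\<in>Q. dist z y < r \<longrightarrow> u y \<le> c} \<noteq> {}"
    using bounded zero_less_one by blast
  from cInf_lessD[OF this c[unfolded upper_env_def]]
  obtain c' r where r: "r > 0" "\<forall>y\<in>Q. dist z y < r \<longrightarrow> u y \<le> c'" "c' < c" by blast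
  have "upper_env Q u y < c" if y: "y \<in> Q \<inter> ball z r" for y
  proof -
    have "upper_env Q u y \<le> c'"
    proof (rule upper_env_le)
      show "0 < r - dist z y" using y by auto
      show "u x \<le> c'" if "x \<in> Q" "dist y x < r - dist z y" for x
        using r(2) that dist_triangle[of z x y] by auto
    qed (use y in auto)
    then show ?thesis using r(3) by simp
  qed
  with r(1) show "\<exists>e>0. \<forall>y\<in>Q \<inter> ball z e. upper_env Q u y < c" by blast
qed

lemma upper_env_le_usc:
  assumes "usc_on Q g" "\<And>y. y \<in> Q \<Longrightarrow> u y \<le> g y" "z \<in> Q"
  shows "upper_env Q u z \<le> g z"
proof (rule dense_ge)
  fix c assume "g z < c"
  from usc_onD[OF assms(1,3) this] obtain e where "e > 0" "\<And>y. y \<in> Q \<Longrightarrow> dist z y < e \<Longrightarrow> g y < c"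
    by metis
  then show "upper_env Q u z \<le> c"
    by (intro upper_env_le[OF assms(3)]) (use assms(2) in force)+
qed

end

lemma local_max_at_cong:
  assumes "\<And>y. y \<in> Q \<Longrightarrow> f y = g y" "z \<in> Q"
  shows "local_max_at Q f z \<longleftrightarrow> local_max_at Q g z"
  unfolding local_max_at_def using assms by (intro ex_cong1 conj_cong ball_cong) auto

lemma visc_sub_cong:
  assumes "\<And>y. y \<in> Q \<Longrightarrow> u y = w y"
  shows "visc_sub Q H u \<longleftrightarrow> visc_sub Q H w"
proof -
  have "local_max_at Q (\<lambda>y. u y - \<phi> y) z = local_max_at Q (\<lambda>y. w y - \<phi> y) z" if "z \<in> Q" for \<phi> z
    using assms that by (intro local_max_at_cong) auto
  then show ?thesis unfolding visc_sub_def using assms by (metis (no_types, lifting))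
qed

lemma visc_sub_max:
  assumes "visc_sub Q H u" "visc_sub Q H w"
  shows "visc_sub Q H (\<lambda>y. max (u y) (w y))"
  unfolding visc_sub_def
proof (intro allI impI, elim conjE)
  fix \<phi> G z
  assume G: "\<forall>y\<in>Q. GDERIV \<phi> y :> G y" "continuous_on Q G" and z: "z \<in> Q"
    and "local_max_at Q (\<lambda>y. max (u y) (w y) - \<phi> y) z"
  then obtain e where e: "e > 0" "\<And>y. y \<in> Q \<Longrightarrow> dist z y < e \<Longrightarrow>
      max (u y) (w y) - \<phi> y \<le> max (u z) (w z) - \<phi> z"
    unfolding local_max_at_def by auto
  show "H z (max (u z) (w z)) (G z) \<le> 0"
  proof (cases "w z \<le> u z")
    case True
    have "H z (u z) (G z) \<le> 0"
      by (rule visc_subD[OF assms(1) _ G(2) z e(1), of \<phi>]) (use G e(2) True in \<open>force+\<close>)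
    then show ?thesis using True by (simp add: max_absorb1)
  next
    case False
    have "H z (w z) (G z) \<le> 0"
      by (rule visc_subD[OF assms(2) _ G(2) z e(1), of \<phi>]) (use G e(2) False in \<open>force+\<close>)
    then show ?thesis using False by (simp add: max_def)
  qed
qed

text \<open>The bump does not show in the outer half of the ball, so \<open>W\<close> agrees with
  \<open>u\<close> near the rim and only local arguments remain. Where \<open>W\<close> exceeds
  \<open>u\<close> it is the differentiable \<open>\<theta>\<close>, so any test function touching
  there has gradient \<open>D\<close> and the classical inequality applies.\<close>

lemma visc_sub_bump:
  fixes Q :: "'a::euclidean_space set"
  assumes "open Q" "usc_on Q u" "visc_sub Q H u" "r > 0"
    and \<theta>: "\<And>y. y \<in> Q \<Longrightarrow> dist z y < r \<Longrightarrow> GDERIV \<theta> y :> D y"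
      "\<And>y. y \<in> Q \<Longrightarrow> dist z y < r \<Longrightarrow> H y (\<theta> y) (D y) \<le> 0"
    and le: "\<And>y. y \<in> Q \<Longrightarrow> r / 2 \<le> dist z y \<Longrightarrow> dist z y < r \<Longrightarrow> \<theta> y \<le> u y"
  defines "W \<equiv> \<lambda>y. if dist z y < r then max (u y) (\<theta> y) else u y"
  shows "usc_on Q W" "visc_sub Q H W"
proof -
  show "usc_on Q W"
    unfolding usc_on_def
  proof (intro ballI allI impI)
    fix y c assume y: "y \<in> Q" and c: "W y < c"
    have "u y < c" using c by (auto simp: W_def split: if_splits)
    from usc_on_less_near[OF assms(2) y this]
    obtain e1 where e1: "e1 > 0" "\<And>x. x \<in> Q \<Longrightarrow> dist y x < e1 \<Longrightarrow> u x < c" by blast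
    show "\<exists>e>0. \<forall>x\<in>Q \<inter> ball y e. W x < c"
    proof (cases "dist z y < r")
      case True
      then have "isCont \<theta> y"
        using \<theta>(1)[OF y] unfolding gderiv_def by (blast intro: has_derivative_continuous)
      moreover have "\<theta> y < c" using c True by (simp add: W_def)
      ultimately have "eventually (\<lambda>x. \<theta> x < c) (nhds y)"
        unfolding isCont_def tendsto_at_iff_tendsto_nhds by (rule order_tendstoD)
      then obtain e2 where e2: "e2 > 0" "\<And>x. dist x y < e2 \<Longrightarrow> \<theta> x < c"
        unfolding eventually_nhds_metric by blast
      have "W x < c" if "x \<in> Q \<inter> ball y (min e1 e2)" for x
        using e1(2)[of x] e2(2)[of x] that by (auto simp: W_def dist_commute)
      with e1(1) e2(1) show ?thesis by (intro exI[of _ "min e1 e2"]) auto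
    next
      case False
      have "W x < c" if x: "x \<in> Q \<inter> ball y (min e1 (r / 2))" for x
      proof -
        have "r / 2 \<le> dist z x" using False x dist_triangle[of z y x] by (auto simp: dist_commute)
        then have "W x = u x" using le[of x] x by (auto simp: W_def)
        then show ?thesis using e1(2) x by auto
      qed
      with e1(1) assms(4) show ?thesis by (intro exI[of _ "min e1 (r / 2)"]) auto
    qed
  qed
  show "visc_sub Q H W"
    unfolding visc_sub_def
  proof (intro allI impI, elim conjE)
    fix \<phi> G y
    assume G: "\<forall>y\<in>Q. GDERIV \<phi> y :> G y" "continuous_on Q G" and y: "y \<in> Q"
      and "local_max_at Q (\<lambda>y. W y - \<phi> y) y"
    then obtain e where e: "e > 0" "\<And>x. x \<in> Q \<Longrightarrow> dist y x < e \<Longrightarrow> W x - \<phi> x \<le> W y - \<phi> y"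
      unfolding local_max_at_def by auto
    have uW: "u x \<le> W x" for x by (simp add: W_def)
    show "H y (W y) (G y) \<le> 0"
    proof (cases "W y = u y")
      case True
      have "u x - \<phi> x \<le> u y - \<phi> y" if "x \<in> Q" "dist y x < e" for x
        using e(2)[OF that] uW[of x] True by simp
      then have "H y (u y) (G y) \<le> 0"
        using visc_subD[OF assms(3) _ G(2) y e(1), of \<phi>] G(1) by blast
      then show ?thesis using True by simp
    next
      case False
      then have yr: "dist z y < r" and Wy: "W y = \<theta> y" by (auto simp: W_def max_def split: if_splits)
      define S where "S = Q \<inter> ball y e \<inter> ball z r"
      have "((\<lambda>x. \<theta> x - \<phi> x) has_derivative (\<lambda>v. v \<bullet> D y - v \<bullet> G y)) (at y)"
        using \<theta>(1)[OF y yr] G(1) y unfolding gderiv_def by (intro has_derivative_diff) auto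
      moreover have "\<theta> x - \<phi> x \<le> \<theta> y - \<phi> y" if "x \<in> S" for x
        using e(2)[of x] that Wy by (auto simp: S_def W_def)
      moreover have "y \<in> S" "open S" using y yr e(1) assms(1) by (auto simp: S_def)
      ultimately have "(\<lambda>v. v \<bullet> D y - v \<bullet> G y) = (\<lambda>v. 0)"
        by (intro differential_zero_maxmin) auto
      then have "(D y - G y) \<bullet> D y - (D y - G y) \<bullet> G y = 0" by meson
      then have "D y = G y" by (simp flip: inner_diff_right)
      then show ?thesis using \<theta>(2)[OF y yr] Wy by simp
    qed
  qed
qed

lemma dist_triple_le:
  "dist (a, b, c) (a', b', c') \<le> dist a a' + dist b b' + dist c c'"
  using sqrt_sum_squares_le_sum[of "dist a a'" "dist (b, c) (b', c')"]
    sqrt_sum_squares_le_sum[of "dist b b'" "dist c c'"]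
  by (simp add: dist_Pair_Pair)

lemma GDERIV_add_square:
  fixes z :: "'a::euclidean_space"
  assumes "GDERIV \<phi> y :> G"
  shows "GDERIV (\<lambda>y. \<phi> y + (y - z) \<bullet> (y - z)) y :> G + 2 *\<^sub>R (y - z)"
proof -
  have "((\<lambda>y. \<phi> y + (y - z) \<bullet> (y - z)) has_derivative
      (\<lambda>v. v \<bullet> G + ((y - z) \<bullet> (v - 0) + (v - 0) \<bullet> (y - z)))) (at y)"
    using assms unfolding gderiv_def
    by (intro has_derivative_add has_derivative_inner has_derivative_diff
        has_derivative_ident has_derivative_const)
  then show ?thesis
    unfolding gderiv_def
    by (rule has_derivative_eq_rhs) (simp add: fun_eq_iff inner_add_right inner_commute)
qed

locale odd_hamiltonian =
  fixes Q :: "'a::euclidean_space set" and H :: "'a \<Rightarrow> real \<Rightarrow> 'a \<Rightarrow> real"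
  assumes open_Q: "open Q"
    and cont_H: "continuous_on (Q \<times> UNIV \<times> UNIV) (\<lambda>(z, a, q). H z a q)"
    and odd_H: "z \<in> Q \<Longrightarrow> H z (- a) (- q) = - H z a q"
begin

text \<open>The term \<open>2 *\<^sub>R (y - z)\<close> is the gradient of the square that makes a local maximum strict.\<close>

lemma violation_near:
  assumes "z \<in> Q" "H z a (G z) > 0" "\<And>y. y \<in> Q \<Longrightarrow> GDERIV \<phi> y :> G y" "continuous_on Q G" "e > 0"
  obtains d r where "d > 0" "r > 0" "r < e" "cball z r \<subseteq> Q"
    "\<And>y. dist z y \<le> r \<Longrightarrow> \<bar>\<phi> y - \<phi> z\<bar> + (y - z) \<bullet> (y - z) < d"
    "\<And>y b. dist z y \<le> r \<Longrightarrow> \<bar>b - a\<bar> < 3 * d \<Longrightarrow> H y b (G y + 2 *\<^sub>R (y - z)) > 0"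
proof -
  obtain d0 where d0: "d0 > 0" "\<And>w. w \<in> Q \<times> UNIV \<times> UNIV \<Longrightarrow> dist w (z, a, G z) < d0 \<Longrightarrow>
      dist ((\<lambda>(z, a, q). H z a q) w) (H z a (G z)) < H z a (G z)"
    using cont_H assms(1,2) unfolding continuous_on_iff by fastforce
  \<comment> \<open>Distances \<open>d\<close>, \<open>3 * d\<close> and \<open>d\<close> of point,
    value and gradient add up to \<open>d0\<close>; the larger share goes to the value, whose
    estimate in the uses below is the coarsest.\<close>
  define d where "d = d0 / 5"
  have d: "d > 0" using d0 by (simp add: d_def)
  have zQ: "at z within Q = at z" using assms(1) open_Q by (rule at_within_open)
  have "((\<lambda>y. G y + 2 *\<^sub>R (y - z)) \<longlongrightarrow> G z + 2 *\<^sub>R (z - z)) (at z)"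
    using assms(1,4) zQ by (intro tendsto_intros) (auto simp: continuous_on_def)
  then have ev1: "eventually (\<lambda>y. dist (G y + 2 *\<^sub>R (y - z)) (G z) < d) (at z)"
    using d by (auto dest: tendstoD)
  have "isCont \<phi> z" using assms(1,3) unfolding gderiv_def by (blast intro: has_derivative_continuous)
  then have "((\<lambda>y. \<bar>\<phi> y - \<phi> z\<bar> + (y - z) \<bullet> (y - z)) \<longlongrightarrow> \<bar>\<phi> z - \<phi> z\<bar> + (z - z) \<bullet> (z - z)) (at z)"
    by (intro tendsto_intros) (simp add: isCont_def)
  then have ev2: "eventually (\<lambda>y. \<bar>\<phi> y - \<phi> z\<bar> + (y - z) \<bullet> (y - z) < d) (at z)"
    using d by (auto dest: order_tendstoD(2))
  obtain s where s: "s > 0" "\<And>y. y \<noteq> z \<Longrightarrow> dist y z < s \<Longrightarrow>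
      dist (G y + 2 *\<^sub>R (y - z)) (G z) < d \<and> \<bar>\<phi> y - \<phi> z\<bar> + (y - z) \<bullet> (y - z) < d"
    using eventually_conj[OF ev1 ev2] unfolding eventually_at by blast
  obtain s' where s': "s' > 0" "cball z s' \<subseteq> Q" using open_Q assms(1) open_contains_cball by blast
  define r where "r = Min {s / 2, s', d / 2, e / 2}"
  have r: "r > 0" "r < s" "r \<le> s'" "r < d" "r < e"
    using s(1) s'(1) d assms(5) by (auto simp: r_def)
  have near: "dist (G y + 2 *\<^sub>R (y - z)) (G z) < d \<and> \<bar>\<phi> y - \<phi> z\<bar> + (y - z) \<bullet> (y - z) < d"
    if "dist z y \<le> r" for y
    using s(2)[of y] that r(2) d by (cases "y = z") (auto simp: dist_commute)
  have sub: "cball z r \<subseteq> Q" using s'(2) r(3) by auto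
  show thesis
  proof
    fix y b assume y: "dist z y \<le> r" and b: "\<bar>b - a\<bar> < 3 * d"
    have "dist (y, b, G y + 2 *\<^sub>R (y - z)) (z, a, G z)
        \<le> dist y z + dist b a + dist (G y + 2 *\<^sub>R (y - z)) (G z)" by (rule dist_triple_le)
    also have "\<dots> < d + 3 * d + d"
      using near[OF y] b y r(4) by (intro add_strict_mono) (auto simp: dist_real_def dist_commute)
    finally have "dist (y, b, G y + 2 *\<^sub>R (y - z)) (z, a, G z) < d0" by (simp add: d_def)
    moreover have "y \<in> Q" using sub y by auto
    ultimately show "H y b (G y + 2 *\<^sub>R (y - z)) > 0"
      using d0(2)[of "(y, b, G y + 2 *\<^sub>R (y - z))"] by (auto simp: dist_real_def)
  qed (use d r sub near in auto)
qed

text \<open>Adding a square makes the maximum of \<open>U - \<phi>\<close> at \<open>z\<close>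
  strict. A member \<open>w\<close> of the family that almost reaches \<open>U z\<close> close to
  \<open>z\<close> then has the maximum of \<open>w - \<phi>'\<close> over the ball in its interior,
  at a point where value and gradient are so close to those at \<open>z\<close> that the test for
  \<open>w\<close> itself is violated.\<close>

lemma visc_sub_Sup:
  assumes S: "S \<noteq> {}" "\<And>w. w \<in> S \<Longrightarrow> usc_on Q w" "\<And>w. w \<in> S \<Longrightarrow> visc_sub Q H w"
    and bd: "\<And>w y. w \<in> S \<Longrightarrow> y \<in> Q \<Longrightarrow> w y \<le> M"
  defines "U \<equiv> upper_env Q (\<lambda>y. SUP w\<in>S. w y)"
  shows "visc_sub Q H U"
  unfolding visc_sub_def
proof (intro allI impI, elim conjE)
  fix \<phi> G z
  assume G: "\<forall>y\<in>Q. GDERIV \<phi> y :> G y" "continuous_on Q G" and z: "z \<in> Q"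
    and "local_max_at Q (\<lambda>y. U y - \<phi> y) z"
  then obtain e where e: "e > 0" "\<And>y. y \<in> Q \<Longrightarrow> dist z y < e \<Longrightarrow> U y - \<phi> y \<le> U z - \<phi> z"
    unfolding local_max_at_def by auto
  have sup_le: "(SUP w\<in>S. w y) \<le> M" if "y \<in> Q" for y
    using S(1) bd that by (intro cSUP_least) auto
  have w_le: "w y \<le> U y" if "w \<in> S" "y \<in> Q" for w y
  proof -
    have "w y \<le> (SUP w\<in>S. w y)" using that bd by (intro cSUP_upper bdd_aboveI2[of _ _ M]) auto
    also have "\<dots> \<le> U y" unfolding U_def by (rule upper_env_ge[OF sup_le that(2)])
    finally show ?thesis .
  qed
  show "H z (U z) (G z) \<le> 0"
  proof (rule ccontr)
    assume "\<not> ?thesis"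
    then have "H z (U z) (G z) > 0" by simp
    then obtain d r where dr: "d > 0" "r > 0" "r < e" "cball z r \<subseteq> Q"
      "\<And>y. dist z y \<le> r \<Longrightarrow> \<bar>\<phi> y - \<phi> z\<bar> + (y - z) \<bullet> (y - z) < d"
      "\<And>y b. dist z y \<le> r \<Longrightarrow> \<bar>b - U z\<bar> < 3 * d \<Longrightarrow> H y b (G y + 2 *\<^sub>R (y - z)) > 0"
      using violation_near[OF z _ _ G(2) e(1), of "U z" \<phi>] G(1) by metis
    define \<phi>' where "\<phi>' = (\<lambda>y. \<phi> y + (y - z) \<bullet> (y - z))"
    define G' where "G' = (\<lambda>y. G y + 2 *\<^sub>R (y - z))"
    have G': "GDERIV \<phi>' y :> G' y" if "y \<in> Q" for y
      unfolding \<phi>'_def G'_def using G(1) that by (intro GDERIV_add_square) auto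
    have contG': "continuous_on Q G'" unfolding G'_def by (intro continuous_intros G(2))
    have cont_\<phi>': "continuous_on Q \<phi>'"
      by (meson G' continuous_at_imp_continuous_on gderiv_def has_derivative_continuous)
    \<comment> \<open>The squared distance of the maximum point from \<open>z\<close> will be below
      \<open>2 * \<kappa>\<close>, so \<open>r^2 / 4\<close> keeps that point inside the open ball;
      \<open>\<kappa> \<le> d\<close> limits the deviation of the value to
      \<open>d + 2 * d\<close>.\<close>
    define \<kappa> where "\<kappa> = min (r\<^sup>2 / 4) d"
    have \<kappa>: "\<kappa> > 0" using dr by (simp add: \<kappa>_def)
    obtain r' where r': "r' > 0" "\<And>y. y \<in> Q \<Longrightarrow> dist z y < r' \<Longrightarrow> \<phi>' y < \<phi>' z + \<kappa>"
      using usc_onD[OF continuous_on_imp_usc_on[OF cont_\<phi>'] z, of "\<phi>' z + \<kappa>"] \<kappa> by auto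
    have "min r r' > 0" "U z - \<kappa> < upper_env Q (\<lambda>y. SUP w\<in>S. w y) z"
      using dr(2) r'(1) \<kappa> by (simp_all add: U_def)
    from upper_env_near[OF sup_le z this]
    obtain x where x: "x \<in> Q" "dist z x < min r r'" "U z - \<kappa> < (SUP w\<in>S. w x)" by metis
    then obtain w where w: "w \<in> S" "U z - \<kappa> < w x"
      using S(1) bd less_cSUP_iff[of S "\<lambda>w. w x"] by (meson bdd_aboveI2)
    have "usc_on (cball z r) (\<lambda>y. w y + - \<phi>' y)"
      by (intro usc_on_add usc_on_subset[OF S(2)[OF w(1)] dr(4)] continuous_on_imp_usc_on
          continuous_on_minus continuous_on_subset[OF cont_\<phi>' dr(4)])
    moreover have "cball z r \<noteq> {}" using dr(2) by simp
    ultimately obtain y where y: "y \<in> cball z r"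
        "\<And>x. x \<in> cball z r \<Longrightarrow> w x + - \<phi>' x \<le> w y + - \<phi>' y"
      using usc_on_attains_max[OF compact_cball] by blast
    have yQ: "y \<in> Q" using y(1) dr(4) by auto
    have 1: "w x - \<phi>' x \<le> w y - \<phi>' y" using y(2)[of x] x by auto
    have 2: "\<phi>' x < \<phi>' z + \<kappa>" using r' x by auto
    have 3: "w y \<le> U y" by (rule w_le[OF w(1) yQ])
    have 4: "U y - \<phi> y \<le> U z - \<phi> z" using e(2)[OF yQ] y(1) dr(3) by auto
    have sq: "(y - z) \<bullet> (y - z) < 2 * \<kappa>"
      using 1 2 3 4 w(2) by (simp add: \<phi>'_def)
    also have "\<dots> \<le> r\<^sup>2 / 2" by (simp add: \<kappa>_def)
    also have "\<dots> < r\<^sup>2" using dr(2) by simp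
    finally have "(norm (y - z))\<^sup>2 < r\<^sup>2" by (simp add: power2_norm_eq_inner)
    then have "norm (y - z) < r" by (rule power2_less_imp_less) (use dr(2) in simp)
    then have yr: "dist z y < r" by (simp add: dist_norm norm_minus_commute)
    have "H y (w y) (G' y) \<le> 0"
    proof (rule visc_subD[OF S(3)[OF w(1)] G' contG' yQ])
      show "0 < r - dist z y" using yr by simp
      show "w q - \<phi>' q \<le> w y - \<phi>' y" if "dist y q < r - dist z y" for q
        using y(2)[of q] that dist_triangle[of z q y] by auto
    qed
    moreover have "\<bar>w y - U z\<bar> < 3 * d"
    proof -
      have "\<bar>\<phi> y - \<phi> z\<bar> + (y - z) \<bullet> (y - z) < d" using dr(5) y(1) by auto
      moreover have "0 \<le> (y - z) \<bullet> (y - z)" by simp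
      moreover have "\<kappa> \<le> d" by (simp add: \<kappa>_def)
      moreover have "(z - z) \<bullet> (z - z) = 0" by simp
      ultimately show ?thesis
        using 1[unfolded \<phi>'_def] 2[unfolded \<phi>'_def] 3 4 w(2) by linarith
    qed
    ultimately show False using dr(6)[of y "w y"] y(1) by (simp add: G'_def)
  qed
qed

text \<open>The envelope \<open>U\<close> of all subsolutions between the barriers is itself one of
  them. If its lower envelope \<open>- N\<close> failed the supersolution test, \<open>U\<close>
  could be raised near the point of failure without leaving the class, against maximality.\<close>

proposition perron:
  assumes cont: "continuous_on Q f" "continuous_on Q g"
    and le: "\<And>y. y \<in> Q \<Longrightarrow> f y \<le> g y"
    and bound: "\<And>y. y \<in> Q \<Longrightarrow> - M \<le> f y" "\<And>y. y \<in> Q \<Longrightarrow> g y \<le> M"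
    and sub: "visc_sub Q H f" "visc_sub Q H (\<lambda>y. - g y)"
  obtains u where "usc_on Q u" "\<And>y. y \<in> Q \<Longrightarrow> f y \<le> u y" "\<And>y. y \<in> Q \<Longrightarrow> u y \<le> g y"
    "visc_sub Q H u" "visc_sub Q H (upper_env Q (\<lambda>y. - u y))"
proof -
  define S where "S = {w. usc_on Q w \<and> visc_sub Q H w \<and> (\<forall>y\<in>Q. f y \<le> w y \<and> w y \<le> g y)}"
  have fS: "f \<in> S" using continuous_on_imp_usc_on[OF cont(1)] sub le by (auto simp: S_def)
  have S_le: "w y \<le> M" if "w \<in> S" "y \<in> Q" for w y
    using that bound(2)[of y] by (force simp: S_def)
  define s where "s = (\<lambda>y. SUP w\<in>S. w y)"
  define U where "U = upper_env Q s"
  have s_le: "s y \<le> g y" if "y \<in> Q" for y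
    unfolding s_def using fS that by (intro cSUP_least) (auto simp: S_def)
  then have sM: "s y \<le> M" if "y \<in> Q" for y using bound(2)[OF that] that by force
  have w_le: "w y \<le> U y" if "w \<in> S" "y \<in> Q" for w y
  proof -
    have "w y \<le> s y" unfolding s_def using that S_le by (intro cSUP_upper bdd_aboveI2[of _ _ M]) auto
    also have "\<dots> \<le> U y" unfolding U_def by (rule upper_env_ge[OF sM that(2)])
    finally show ?thesis .
  qed
  have uscU: "usc_on Q U" unfolding U_def by (rule usc_on_upper_env[OF sM])
  have fU: "f y \<le> U y" if "y \<in> Q" for y using w_le[OF fS that] .
  have Ug: "U y \<le> g y" if "y \<in> Q" for y
    unfolding U_def by (rule upper_env_le_usc[OF sM continuous_on_imp_usc_on[OF cont(2)] s_le that])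
  have subU: "visc_sub Q H U"
    unfolding U_def s_def by (rule visc_sub_Sup) (use fS S_le in \<open>auto simp: S_def\<close>)
  define N where "N = upper_env Q (\<lambda>y. - U y)"
  have negU: "- U y \<le> M" if "y \<in> Q" for y using fU[OF that] bound(1)[OF that] by simp
  have N_ge: "- U y \<le> N y" if "y \<in> Q" for y unfolding N_def by (rule upper_env_ge[OF negU that])
  have "visc_sub Q H N"
    unfolding visc_sub_def
  proof (intro allI impI, elim conjE)
    fix \<phi> G z
    assume G: "\<forall>y\<in>Q. GDERIV \<phi> y :> G y" "continuous_on Q G" and z: "z \<in> Q"
      and "local_max_at Q (\<lambda>y. N y - \<phi> y) z"
    then obtain e where e: "e > 0" "\<And>y. y \<in> Q \<Longrightarrow> dist z y < e \<Longrightarrow> N y - \<phi> y \<le> N z - \<phi> z"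
      unfolding local_max_at_def by auto
    show "H z (N z) (G z) \<le> 0"
    proof (rule ccontr)
      assume "\<not> ?thesis"
      then have viol: "H z (N z) (G z) > 0" by simp
      \<comment> \<open>At contact with the upper barrier the test function also touches
        \<open>- g\<close>, which passes the test; so a violation leaves room below
        \<open>g\<close>.\<close>
      have "N z \<noteq> - g z"
      proof
        assume eq: "N z = - g z"
        have "- g y - \<phi> y \<le> - g z - \<phi> z" if "y \<in> Q" "dist z y < e" for y
          using e(2)[OF that] N_ge[OF that(1)] Ug[OF that(1)] eq by linarith
        then have "H z (- g z) (G z) \<le> 0"
          using visc_subD[OF sub(2) _ G(2) z e(1), of \<phi>] G(1) by blast
        then show False using viol eq by simp
      qed
      \<comment> \<open>A quarter of the room: the variation of \<open>g\<close>, the variation of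
        \<open>\<phi>\<close> and the lift \<open>\<kappa>\<close> use up at most three quarters
        when the bump is shown to stay below \<open>g\<close>.\<close>
      define gap where "gap = (g z + N z) / 4"
      have gap: "gap > 0" using N_ge[OF z] Ug[OF z] \<open>N z \<noteq> - g z\<close> by (simp add: gap_def)
      have "- g z < - g z + gap" using gap by simp
      from usc_on_less_near[OF continuous_on_imp_usc_on[OF continuous_on_minus[OF cont(2)]] z this]
      obtain e1 where e1: "e1 > 0" "\<And>y. y \<in> Q \<Longrightarrow> dist z y < e1 \<Longrightarrow> - g y < - g z + gap" by blast
      have cont_\<phi>: "continuous_on Q \<phi>"
        using G(1) by (meson continuous_at_imp_continuous_on gderiv_def has_derivative_continuous)
      have "- \<phi> z < - \<phi> z + gap" using gap by simp
      from usc_on_less_near[OF continuous_on_imp_usc_on[OF continuous_on_minus[OF cont_\<phi>]] z this]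
      obtain e2 where e2: "e2 > 0" "\<And>y. y \<in> Q \<Longrightarrow> dist z y < e2 \<Longrightarrow> - \<phi> y < - \<phi> z + gap" by blast
      have "min e (min e1 e2) > 0" using e e1 e2 by simp
      from violation_near[OF z viol _ G(2) this, of \<phi>] G(1)
      obtain d r where dr: "d > 0" "r > 0" "r < min e (min e1 e2)" "cball z r \<subseteq> Q"
        "\<And>y. dist z y \<le> r \<Longrightarrow> \<bar>\<phi> y - \<phi> z\<bar> + (y - z) \<bullet> (y - z) < d"
        "\<And>y b. dist z y \<le> r \<Longrightarrow> \<bar>b - N z\<bar> < 3 * d \<Longrightarrow> H y b (G y + 2 *\<^sub>R (y - z)) > 0"
        by metis
      define \<kappa> where "\<kappa> = Min {r\<^sup>2 / 4, d, gap}"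
      have \<kappa>: "\<kappa> > 0" "\<kappa> \<le> r\<^sup>2 / 4" "\<kappa> \<le> d" "\<kappa> \<le> gap" using dr gap by (auto simp: \<kappa>_def)
      \<comment> \<open>The reflected test function, bent down by the square and lifted so that
        \<open>\<theta> z = - N z + \<kappa>\<close>. It thus exceeds \<open>U\<close> at points
        arbitrarily close to \<open>z\<close>, while at distance at least \<open>r / 2\<close> the
        square absorbs the lift.\<close>
      define \<theta> where "\<theta> = (\<lambda>y. - (\<phi> y + (y - z) \<bullet> (y - z)) + (\<phi> z - N z + \<kappa>))"
      define D where "D = (\<lambda>y. - (G y + 2 *\<^sub>R (y - z)))"
      define W where "W = (\<lambda>y. if dist z y < r then max (U y) (\<theta> y) else U y)"
      have rQ: "y \<in> Q" if "dist z y < r" for y using that dr(4) by auto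
      have 1: "\<theta> y + (y - z) \<bullet> (y - z) - \<kappa> \<le> U y" if "y \<in> Q" "dist z y < r" for y
        using e(2)[OF that(1)] N_ge[OF that(1)] that(2) dr(3) by (simp add: \<theta>_def)
      have D\<theta>: "GDERIV \<theta> y :> D y" if "y \<in> Q" for y
      proof -
        have "GDERIV (\<lambda>y. \<phi> y + (y - z) \<bullet> (y - z)) y :> G y + 2 *\<^sub>R (y - z)"
          using G(1) that by (intro GDERIV_add_square) auto
        then have "(\<theta> has_derivative (\<lambda>v. - (v \<bullet> (G y + 2 *\<^sub>R (y - z))) + 0)) (at y)"
          unfolding \<theta>_def gderiv_def
          by (intro has_derivative_add has_derivative_minus has_derivative_const)
        then show ?thesis
          unfolding gderiv_def D_def by (rule has_derivative_eq_rhs) (simp only: fun_eq_iff inner_minus_right add_0_right simp_thms)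
      qed
      have H\<theta>: "H y (\<theta> y) (D y) \<le> 0" if "y \<in> Q" "dist z y < r" for y
      proof -
        have "\<bar>- \<theta> y - N z\<bar> < 3 * d"
          using dr(5)[of y] that(2) \<kappa>(1,3) inner_ge_zero[of "y - z"] unfolding \<theta>_def by linarith
        then have "H y (- \<theta> y) (G y + 2 *\<^sub>R (y - z)) > 0" using dr(6)[of y "- \<theta> y"] that(2) by simp
        \<comment> \<open>Oddness turns the violated test for \<open>N\<close> into the subsolution
          inequality for the bump.\<close>
        moreover have "H y (- \<theta> y) (G y + 2 *\<^sub>R (y - z)) = - H y (\<theta> y) (D y)"
          using odd_H[OF that(1), of "\<theta> y" "D y"] unfolding D_def minus_minus .
        ultimately show ?thesis by linarith
      qed
      have far: "\<theta> y \<le> U y" if "y \<in> Q" "r / 2 \<le> dist z y" "dist z y < r" for y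
      proof -
        have "(r / 2)\<^sup>2 \<le> (norm (y - z))\<^sup>2"
          using that(2) dr(2) by (intro power_mono) (auto simp: dist_norm norm_minus_commute)
        then have "r\<^sup>2 / 4 \<le> (y - z) \<bullet> (y - z)" by (simp add: power2_norm_eq_inner power_divide)
        then show ?thesis using 1[OF that(1,3)] \<kappa>(2) by linarith
      qed
      have "usc_on Q W" "visc_sub Q H W"
        unfolding W_def
        by (rule visc_sub_bump[OF open_Q uscU subU dr(2) D\<theta> H\<theta> far]; assumption)+
      moreover have "f y \<le> W y" "W y \<le> g y" if "y \<in> Q" for y
      proof -
        show "f y \<le> W y" using fU[OF that] by (auto simp: W_def)
        have "\<theta> y \<le> g y" if r: "dist z y < r"
        proof -
          have "0 \<le> (y - z) \<bullet> (y - z)" "4 * gap = g z + N z" by (simp_all add: gap_def)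
          moreover have "- g y < - g z + gap" "- \<phi> y < - \<phi> z + gap"
            using e1(2)[OF \<open>y \<in> Q\<close>] e2(2)[OF \<open>y \<in> Q\<close>] r dr(3) by auto
          ultimately show ?thesis using \<kappa>(4) gap unfolding \<theta>_def by linarith
        qed
        then show "W y \<le> g y" using Ug[OF that] by (auto simp: W_def)
      qed
      ultimately have "W \<in> S" by (simp add: S_def)
      \<comment> \<open>To contradict maximality, a point is chosen where \<open>- U\<close> nearly
        attains \<open>N z\<close> and the bent test function has hardly grown; half of
        \<open>\<kappa>\<close> is spent on each.\<close>
      have "usc_on Q (\<lambda>y. \<phi> y + (y - z) \<bullet> (y - z))"
        by (intro continuous_on_imp_usc_on continuous_intros cont_\<phi>)
      from usc_on_less_near[OF this z, of "\<phi> z + \<kappa> / 2"] \<kappa>(1)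
      obtain r' where r': "r' > 0" "\<And>y. y \<in> Q \<Longrightarrow> dist z y < r' \<Longrightarrow>
          \<phi> y + (y - z) \<bullet> (y - z) < \<phi> z + \<kappa> / 2" by auto
      have "min r r' > 0" "N z - \<kappa> / 2 < upper_env Q (\<lambda>y. - U y) z"
        using dr(2) r'(1) \<kappa> by (simp_all add: N_def)
      from upper_env_near[OF negU z this]
      obtain y where y: "y \<in> Q" "dist z y < min r r'" "N z - \<kappa> / 2 < - U y" by metis
      have "U y < \<theta> y" using y r'(2)[OF y(1)] by (simp add: \<theta>_def)
      also have "\<theta> y \<le> W y" using y(2) by (simp add: W_def)
      also have "W y \<le> U y" by (rule w_le[OF \<open>W \<in> S\<close> y(1)])
      finally show False by simp
    qed
  qed
  then show thesis using that[OF uscU fU Ug subU] by (simp add: N_def)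
qed

end

section \<open>Flows of Lipschitz vector fields and invariant sets\<close>

text \<open>Integrating the weight gains a factor \<open>1 / k\<close>. For \<open>k = 2 * l\<close>
  and Lipschitz constant \<open>l\<close> this yields the contraction factor 1 / 2 of the Picard
  operator.\<close>

lemma antiderivative_exp_bound:
  fixes F :: "real \<Rightarrow> 'a::real_normed_vector"
  assumes "F \<tau> = 0" "\<And>s. (F has_vector_derivative g s) (at s)"
    and "\<And>s. norm (g s) \<le> c * exp (k * \<bar>s - \<tau>\<bar>)" "k > 0"
  shows "norm (F s) \<le> c / k * exp (k * \<bar>s - \<tau>\<bar>)"
proof -
  have "0 \<le> c * exp (k * \<bar>\<tau> - \<tau>\<bar>)" using order_trans[OF norm_ge_zero assms(3)[of \<tau>]] .
  then have c: "0 \<le> c / k" using assms(4) by simp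
  have contF: "continuous_on A F" for A
    using assms(2) by (meson continuous_at_imp_continuous_on has_vector_derivative_continuous)
  consider "s = \<tau>" | "\<tau> < s" | "s < \<tau>" by linarith
  then show ?thesis
  proof cases
    case 1
    then show ?thesis using assms(1) c by simp
  next
    case 2
    have "norm (F s - F \<tau>) \<le> c / k * exp (k * (s - \<tau>)) - c / k * exp (k * (\<tau> - \<tau>))"
    proof (rule differentiable_bound_general[OF 2 contF])
      show "continuous_on {\<tau>..s} (\<lambda>r. c / k * exp (k * (r - \<tau>)))" by (intro continuous_intros)
      show "((\<lambda>r. c / k * exp (k * (r - \<tau>))) has_vector_derivative c * exp (k * (r - \<tau>))) (at r)" for r
        unfolding has_real_derivative_iff_has_vector_derivative[symmetric]
        by (auto intro!: derivative_eq_intros simp: assms(4)[THEN less_imp_neq, symmetric])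
      show "norm (g r) \<le> c * exp (k * (r - \<tau>))" if "\<tau> < r" for r using assms(3)[of r] that by simp
    qed (rule assms(2))
    then show ?thesis using 2 c assms(1) by simp
  next
    case 3
    have "norm (F \<tau> - F s) \<le> - c / k * exp (k * (\<tau> - \<tau>)) - - c / k * exp (k * (\<tau> - s))"
    proof (rule differentiable_bound_general[OF 3 contF])
      show "continuous_on {s..\<tau>} (\<lambda>r. - c / k * exp (k * (\<tau> - r)))" by (intro continuous_intros)
      show "((\<lambda>r. - c / k * exp (k * (\<tau> - r))) has_vector_derivative c * exp (k * (\<tau> - r))) (at r)" for r
        unfolding has_real_derivative_iff_has_vector_derivative[symmetric]
        by (auto intro!: derivative_eq_intros simp: assms(4)[THEN less_imp_neq, symmetric])
      show "norm (g r) \<le> c * exp (k * (\<tau> - r))" if "r < \<tau>" for r using assms(3)[of r] that by simp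
    qed (rule assms(2))
    then show ?thesis using 3 c assms(1) by simp
  qed
qed

text \<open>Contraction argument in the space of bounded continuous \<open>y\<close>, where
  \<open>x s = \<xi> + exp (2 l \<bar>s - \<tau>\<bar>) y s\<close>; the weight makes the Picard operator a contraction on
  the whole line at once.\<close>

lemma global_lipschitz_ode:
  fixes W :: "real \<Rightarrow> 'a::euclidean_space \<Rightarrow> 'a"
  assumes cont: "continuous_on UNIV (\<lambda>(s, x). W s x)"
    and lip: "\<And>s x y. norm (W s x - W s y) \<le> L * norm (x - y)"
    and bound: "\<And>s. norm (W s \<xi>) \<le> B"
  obtains x where "x \<tau> = \<xi>" "\<And>s. (x has_vector_derivative W s (x s)) (at s)"
proof -
  define l where "l = max L 1"
  have l: "l > 0" "L \<le> l" by (auto simp: l_def)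
  have B: "B \<ge> 0" using order_trans[OF norm_ge_zero bound] .
  define \<omega> where "\<omega> = (\<lambda>s. exp (2 * l * \<bar>s - \<tau>\<bar>))"
  have \<omega>: "\<omega> s \<ge> 1" "\<omega> s > 0" for s using l by (auto simp: \<omega>_def)
  have cont_\<omega>: "continuous_on UNIV \<omega>" unfolding \<omega>_def by (intro continuous_intros)
  define g where "g = (\<lambda>(y :: real \<Rightarrow>\<^sub>C 'a) s. W s (\<xi> + \<omega> s *\<^sub>R y s))"
  have cont_g: "continuous_on UNIV (g y)" for y
  proof -
    have "continuous_on UNIV (\<lambda>s. (\<lambda>(s, x). W s x) (s, \<xi> + \<omega> s *\<^sub>R y s))"
      by (intro continuous_on_compose2[OF cont] continuous_intros cont_\<omega> continuous_on_apply_bcontfun) auto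
    then show ?thesis by (simp add: g_def)
  qed
  have "\<exists>F. F \<tau> = 0 \<and> (\<forall>s. (F has_vector_derivative g y s) (at s))" for y
  proof -
    \<comment> \<open>An antiderivative on the whole line, normalised at \<open>\<tau>\<close>,
      treats both directions of time at once and avoids oriented integrals.\<close>
    have "isCont (g y) s" for s using cont_g by (simp add: continuous_on_eq_continuous_at)
    then obtain F0 where F0: "\<And>s. (F0 has_vector_derivative g y s) (at s)"
      using einterval_antiderivative[of "-\<infinity>" "\<infinity>" "g y"] by auto
    have "((\<lambda>s. F0 s - F0 \<tau>) has_vector_derivative g y s - 0) (at s)" for s
      by (intro has_vector_derivative_diff F0 has_vector_derivative_const)
    then show ?thesis by (intro exI[of _ "\<lambda>s. F0 s - F0 \<tau>"]) simp
  qed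
  then obtain A where A: "\<And>y. A y \<tau> = 0" "\<And>y s. (A y has_vector_derivative g y s) (at s)" by metis
  have g_bound: "norm (g y s) \<le> (B + l * norm y) * \<omega> s" for y s
  proof -
    have "norm (g y s) \<le> norm (W s \<xi>) + norm (g y s - W s \<xi>)" by (rule norm_triangle_sub)
    also have "norm (g y s - W s \<xi>) \<le> L * norm (\<omega> s *\<^sub>R y s)" using lip[of s "\<xi> + \<omega> s *\<^sub>R y s" \<xi>] by (simp add: g_def)
    also have "\<dots> \<le> l * (\<omega> s * norm y)"
      using \<omega>(2)[of s] norm_bounded[of y s] l by (intro mult_mono) auto
    also have "norm (W s \<xi>) \<le> B * \<omega> s" using bound[of s] mult_left_mono[OF \<omega>(1)[of s] B] by simp
    finally show ?thesis by (simp add: algebra_simps)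
  qed
  define T where "T = (\<lambda>y. Bcontfun (\<lambda>s. A y s /\<^sub>R \<omega> s))"
  have T: "apply_bcontfun (T y) = (\<lambda>s. A y s /\<^sub>R \<omega> s)" for y
  proof -
    have A_bound: "norm (A y s) \<le> (B + l * norm y) / (2 * l) * \<omega> s" for s
      using antiderivative_exp_bound[OF A(1) A(2) g_bound[unfolded \<omega>_def], of y s] l by (simp add: \<omega>_def)
    have "norm (A y s /\<^sub>R \<omega> s) \<le> (B + l * norm y) / (2 * l)" for s
    proof -
      have "norm (A y s /\<^sub>R \<omega> s) = norm (A y s) / \<omega> s"
        using \<omega>(2)[of s] by (simp add: divide_inverse mult.commute)
      then show ?thesis using A_bound[of s] \<omega>(2)[of s] by (simp only: pos_divide_le_eq)
    qed
    moreover have "continuous_on UNIV (\<lambda>s. A y s /\<^sub>R \<omega> s)"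
    proof -
      have "continuous_on UNIV (A y)"
        using A(2) by (meson continuous_at_imp_continuous_on has_vector_derivative_continuous)
      then show ?thesis
        by (intro continuous_intros cont_\<omega>) (use \<omega>(2) in \<open>auto simp: less_imp_neq[symmetric]\<close>)
    qed
    ultimately have "(\<lambda>s. A y s /\<^sub>R \<omega> s) \<in> bcontfun" by (intro bcontfun_normI)
    then show ?thesis unfolding T_def by (rule Bcontfun_inverse)
  qed
  have "dist (T y) (T z) \<le> 1 / 2 * dist y z" for y z
  proof (rule dist_bound)
    fix s
    have "norm (g y r - g z r) \<le> (l * dist y z) * exp (2 * l * \<bar>r - \<tau>\<bar>)" for r
    proof -
      have "norm (g y r - g z r) \<le> L * norm (\<omega> r *\<^sub>R (y r - z r))"
        using lip[of r "\<xi> + \<omega> r *\<^sub>R y r" "\<xi> + \<omega> r *\<^sub>R z r"] by (simp add: g_def scaleR_diff_right)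
      also have "\<dots> \<le> l * (\<omega> r * dist y z)"
        using \<omega>(2)[of r] dist_bounded[of y r z] l by (intro mult_mono) (auto simp: dist_norm)
      finally show ?thesis by (simp add: \<omega>_def algebra_simps)
    qed
    moreover have "A y \<tau> - A z \<tau> = 0" by (simp add: A)
    moreover have "((\<lambda>s. A y s - A z s) has_vector_derivative g y s - g z s) (at s)" for s
      by (intro has_vector_derivative_diff A)
    ultimately have "norm (A y s - A z s) \<le> l * dist y z / (2 * l) * exp (2 * l * \<bar>s - \<tau>\<bar>)"
      using antiderivative_exp_bound[of "\<lambda>s. A y s - A z s" \<tau> "\<lambda>s. g y s - g z s" "l * dist y z" "2 * l" s] l
      by simp
    then have "norm (A y s - A z s) \<le> 1 / 2 * dist y z * \<omega> s" using l by (simp add: \<omega>_def)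
    moreover have "dist (T y s) (T z s) = norm (A y s - A z s) / \<omega> s"
      using \<omega>(2)[of s] by (simp add: T dist_norm divide_inverse mult.commute flip: scaleR_diff_right)
    ultimately show "dist (T y s) (T z s) \<le> 1 / 2 * dist y z" using \<omega>(2)[of s] by (simp add: pos_divide_le_eq)
  qed
  then obtain y where y: "T y = y" using banach_fix_type[of "1 / 2" T] by auto
  have "\<omega> s *\<^sub>R y s = A y s" for s
  proof -
    have "y s = A y s /\<^sub>R \<omega> s" using T[of y] y by metis
    then show ?thesis using \<omega>(2)[of s] by simp
  qed
  then have "g y s = W s (\<xi> + A y s)" for s by (simp add: g_def)
  then have "((\<lambda>s. \<xi> + A y s) has_vector_derivative 0 + W s (\<xi> + A y s)) (at s)" for s
    using A(2)[of y s] by (intro has_vector_derivative_add has_vector_derivative_const) simp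
  then show thesis using that[of "\<lambda>s. \<xi> + A y s"] A(1) by simp
qed

text \<open>The squared distance is differentiable even where the curves meet; multiplied by
  \<open>exp (- 2 * L * s)\<close> it is nonincreasing, by Cauchy-Schwarz.\<close>

lemma gronwall_forward:
  fixes x y :: "real \<Rightarrow> 'a::euclidean_space"
  assumes "a \<le> b"
    and x: "\<And>s. s \<in> {a..b} \<Longrightarrow> (x has_vector_derivative x' s) (at s within {a..b})"
    and y: "\<And>s. s \<in> {a..b} \<Longrightarrow> (y has_vector_derivative y' s) (at s within {a..b})"
    and L: "\<And>s. s \<in> {a..b} \<Longrightarrow> norm (x' s - y' s) \<le> L * norm (x s - y s)"
  shows "norm (x b - y b) \<le> exp (L * (b - a)) * norm (x a - y a)"
proof -
  define D where "D = (\<lambda>s. exp (- 2 * L * s) * ((x s - y s) \<bullet> (x s - y s)))"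
  define D' where "D' = (\<lambda>s. exp (- 2 * L * s) * (2 * ((x s - y s) \<bullet> (x' s - y' s)) - 2 * L * ((x s - y s) \<bullet> (x s - y s))))"
  have D: "(D has_real_derivative D' s) (at s within {a..b})" if "s \<in> {a..b}" for s
  proof -
    have d: "((\<lambda>s. x s - y s) has_vector_derivative x' s - y' s) (at s within {a..b})"
      by (intro has_vector_derivative_diff x y that)
    have "((\<lambda>s. (x s - y s) \<bullet> (x s - y s)) has_vector_derivative
        ((x s - y s) \<bullet> (x' s - y' s) + (x' s - y' s) \<bullet> (x s - y s))) (at s within {a..b})"
      using bounded_bilinear.has_vector_derivative[OF bounded_bilinear_inner d d] .
    then have i: "((\<lambda>s. (x s - y s) \<bullet> (x s - y s)) has_real_derivative
        ((x s - y s) \<bullet> (x' s - y' s) + (x' s - y' s) \<bullet> (x s - y s))) (at s within {a..b})"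
      by (simp add: has_real_derivative_iff_has_vector_derivative)
    have e: "((\<lambda>s. exp (- 2 * L * s)) has_real_derivative exp (- 2 * L * s) * (- 2 * L)) (at s within {a..b})"
      by (auto intro!: derivative_eq_intros)
    show ?thesis
      unfolding D_def D'_def using DERIV_mult[OF e i]
      by (rule DERIV_cong) (simp add: inner_commute algebra_simps)
  qed
  have D'_le: "D' s \<le> 0" if "s \<in> {a..b}" for s
  proof -
    have "(x s - y s) \<bullet> (x' s - y' s) \<le> norm (x s - y s) * norm (x' s - y' s)" by (rule norm_cauchy_schwarz)
    also have "\<dots> \<le> norm (x s - y s) * (L * norm (x s - y s))" by (intro mult_left_mono L that) simp
    also have "\<dots> = L * ((x s - y s) \<bullet> (x s - y s))" by (simp add: dot_square_norm power2_eq_square)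
    finally show ?thesis unfolding D'_def by (intro mult_nonneg_nonpos) auto
  qed
  have "D b \<le> D a"
  proof (rule DERIV_nonpos_imp_decreasing_open[OF assms(1)])
    show "continuous_on {a..b} D" using D by (meson DERIV_continuous continuous_on_eq_continuous_within)
    show "\<exists>d. (D has_real_derivative d) (at s) \<and> d \<le> 0" if "a < s" "s < b" for s
      using D[of s] D'_le[of s] that at_within_Icc_at[of a s b] by auto
  qed
  then have "exp (2 * L * b) * D b \<le> exp (2 * L * b) * D a" by simp
  then have "(norm (x b - y b))\<^sup>2 \<le> exp (2 * L * b) * exp (- 2 * L * a) * (norm (x a - y a))\<^sup>2"
    by (simp add: D_def dot_square_norm flip: mult.assoc exp_add)
  also have "\<dots> = (exp (L * (b - a)) * norm (x a - y a))\<^sup>2"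
    by (simp add: power_mult_distrib algebra_simps flip: exp_add exp_double)
  finally show ?thesis by (rule power2_le_imp_le) simp
qed

lemma has_vector_derivative_reverse:
  fixes x :: "real \<Rightarrow> 'a::real_normed_vector"
  assumes "(x has_vector_derivative d) (at (c - s) within {a..b})"
  shows "((\<lambda>r. x (c - r)) has_vector_derivative - d) (at s within {c - b..c - a})"
proof -
  have "(\<lambda>r. c - r) ` {c - b..c - a} = {a..b}"
    by (simp add: image_diff_atLeastAtMost)
  moreover have "((\<lambda>r. c - r) has_vector_derivative 0 - 1) (at s within {c - b..c - a})"
    by (intro has_vector_derivative_diff has_vector_derivative_const has_vector_derivative_id)
  ultimately show ?thesis
    using vector_diff_chain_within[of "\<lambda>r. c - r" "-1" s "{c - b..c - a}" x d] assms by (simp add: o_def)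
qed

text \<open>Time is reflected about the midpoint of the interval.\<close>

lemma gronwall_backward:
  fixes x y :: "real \<Rightarrow> 'a::euclidean_space"
  assumes "a \<le> b"
    and x: "\<And>s. s \<in> {a..b} \<Longrightarrow> (x has_vector_derivative x' s) (at s within {a..b})"
    and y: "\<And>s. s \<in> {a..b} \<Longrightarrow> (y has_vector_derivative y' s) (at s within {a..b})"
    and L: "\<And>s. s \<in> {a..b} \<Longrightarrow> norm (x' s - y' s) \<le> L * norm (x s - y s)"
  shows "norm (x a - y a) \<le> exp (L * (b - a)) * norm (x b - y b)"
proof -
  have "norm (x (a + b - b) - y (a + b - b)) \<le> exp (L * (b - a)) * norm (x (a + b - a) - y (a + b - a))"
  proof (rule gronwall_forward[OF assms(1)])
    fix s assume s: "s \<in> {a..b}"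
    then have s': "a + b - s \<in> {a..b}" by auto
    show "((\<lambda>s. x (a + b - s)) has_vector_derivative - x' (a + b - s)) (at s within {a..b})"
      using has_vector_derivative_reverse[OF x[OF s']] by simp
    show "((\<lambda>s. y (a + b - s)) has_vector_derivative - y' (a + b - s)) (at s within {a..b})"
      using has_vector_derivative_reverse[OF y[OF s']] by simp
    show "norm (- x' (a + b - s) - - y' (a + b - s)) \<le> L * norm (x (a + b - s) - y (a + b - s))"
      using L[OF s'] by (simp add: norm_minus_commute)
  qed
  then show ?thesis by simp
qed

section \<open>Nagumo's invariance theorem\<close>

lemma bouligand_coneD:
  assumes "z \<in> bouligand_cone K y" "\<epsilon> > 0" "\<delta> > 0"
  obtains h where "0 < h" "h < \<delta>" "infdist (y + h *\<^sub>R z) K \<le> \<epsilon> * h"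
proof (rule ccontr)
  note witness = that
  assume none: "\<not> thesis"
  have "ereal \<epsilon> \<le> ereal (infdist (y + h *\<^sub>R z) K / h)" if "0 < h" "h < \<delta>" for h
    using witness[OF that] none that by (force simp: pos_le_divide_eq)
  then have "eventually (\<lambda>h. ereal \<epsilon> \<le> ereal (infdist (y + h *\<^sub>R z) K / h)) (at_right 0)"
    unfolding eventually_at_right_field using assms(3) by auto
  then have "ereal \<epsilon> \<le> Liminf (at_right 0) (\<lambda>h. ereal (infdist (y + h *\<^sub>R z) K / h))"
    by (rule Liminf_bounded)
  then show False using assms(1,2) by (simp add: bouligand_cone_def)
qed

text \<open>Tangency provides only some small steps \<open>h\<close>, so no differential inequality
  for the distance is at hand. Instead the last time with
  \<open>infdist (x s) K \<le> \<epsilon> * exp ((L + 1) * s)\<close> is considered: if it came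
  before \<open>b\<close>, one admissible step from it would lead to a later such time.\<close>

lemma nagumo:
  fixes x :: "real \<Rightarrow> 'a::euclidean_space"
  assumes "closed K" "0 \<le> b"
    and x: "\<And>s. s \<in> {0..b} \<Longrightarrow> (x has_vector_derivative F s (x s)) (at s within {0..b})"
    and lip: "\<And>s p q. s \<in> {0..b} \<Longrightarrow> norm (F s p - F s q) \<le> L * norm (p - q)" and "L \<ge> 0"
    and tangent: "\<And>s y. s \<in> {0..b} \<Longrightarrow> y \<in> K \<Longrightarrow> F s y \<in> bouligand_cone K y"
    and "x 0 \<in> K"
  shows "x b \<in> K"
proof -
  have K: "K \<noteq> {}" using assms by auto
  have cont: "continuous_on {0..b} x"
    using x by (meson continuous_on_eq_continuous_within has_vector_derivative_continuous)
  have main: "infdist (x b) K \<le> \<epsilon> * exp ((L + 1) * b)" if \<epsilon>: "\<epsilon> > 0" for \<epsilon>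
  proof -
    define A where "A = {s \<in> {0..b}. infdist (x s) K \<le> \<epsilon> * exp ((L + 1) * s)}"
    have "closed A"
      unfolding A_def
      by (intro continuous_on_closed_Collect_le continuous_intros cont closed_atLeastAtMost)
    moreover have A0: "0 \<in> A" using assms \<epsilon> by (auto simp: A_def)
    moreover have bdd: "bdd_above A" by (rule bdd_aboveI[of _ b]) (auto simp: A_def)
    ultimately have cA: "Sup A \<in> A" by (intro closed_contains_Sup) auto
    define c where "c = Sup A"
    have c: "0 \<le> c" "c \<le> b" using cA by (auto simp: c_def A_def)
    have "c = b"
    proof (rule ccontr)
      assume "c \<noteq> b"
      then have cb: "c < b" using c by simp
      define \<rho> where "\<rho> = \<epsilon> * exp ((L + 1) * c)"
      have \<rho>: "\<rho> > 0" using \<epsilon> by (simp add: \<rho>_def)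
      have dc: "infdist (x c) K \<le> \<rho>" using cA by (simp add: A_def c_def \<rho>_def)
      obtain y where y: "y \<in> K" "infdist (x c) K = dist (x c) y"
        using infdist_attains_inf[OF assms(1) K] by metis
      have "(x has_derivative (\<lambda>h. h *\<^sub>R F c (x c))) (at c within {0..b})"
        using x[of c] c by (simp add: has_vector_derivative_def)
      then obtain \<delta> where \<delta>: "\<delta> > 0" "\<And>s. s \<in> {0..b} \<Longrightarrow> norm (s - c) < \<delta> \<Longrightarrow>
          norm (x s - x c - (s - c) *\<^sub>R F c (x c)) \<le> \<rho> / 2 * norm (s - c)"
        unfolding has_derivative_within_alt using \<rho> by (meson half_gt_zero)
      have "F c y \<in> bouligand_cone K y" using tangent y(1) c by auto
      \<comment> \<open>The linearisation of \<open>x\<close> and the step out of \<open>K\<close>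
        each cost \<open>\<rho> / 2 * h\<close>; the total \<open>\<rho> * h\<close> is what the
        exponent \<open>L + 1\<close> in place of \<open>L\<close> pays for.\<close>
      then obtain h where h: "0 < h" "h < min \<delta> (b - c)" "infdist (y + h *\<^sub>R F c y) K \<le> \<rho> / 2 * h"
        using bouligand_coneD[of "F c y" K y "\<rho> / 2" "min \<delta> (b - c)"] \<rho> \<delta>(1) cb by auto
      have n1: "norm (x (c + h) - x c - h *\<^sub>R F c (x c)) \<le> \<rho> / 2 * h"
        using \<delta>(2)[of "c + h"] h c by auto
      have split: "x (c + h) - (y + h *\<^sub>R F c y) =
          (x (c + h) - x c - h *\<^sub>R F c (x c)) + (x c - y) + h *\<^sub>R (F c (x c) - F c y)"
        by (simp add: algebra_simps)
      have n2: "norm (h *\<^sub>R (F c (x c) - F c y)) \<le> h * (L * norm (x c - y))"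
        using h lip[of c "x c" y] c by simp
      have "norm (x (c + h) - (y + h *\<^sub>R F c y)) \<le>
          \<rho> / 2 * h + norm (x c - y) + h * (L * norm (x c - y))"
        unfolding split by (intro norm_triangle_le add_mono n1 n2 order_refl)
      moreover have "infdist (x (c + h)) K \<le> infdist (y + h *\<^sub>R F c y) K + norm (x (c + h) - (y + h *\<^sub>R F c y))"
        by (metis infdist_triangle dist_norm)
      moreover have "norm (x c - y) \<le> \<rho>" using dc y by (simp add: dist_norm)
      moreover from this have "h * (L * norm (x c - y)) \<le> h * (L * \<rho>)"
        using h \<open>L \<ge> 0\<close> by (intro mult_left_mono) auto
      ultimately have "infdist (x (c + h)) K \<le> \<rho> * (1 + (L + 1) * h)"
        using h(3) by (simp add: algebra_simps)
      also have "\<dots> \<le> \<rho> * exp ((L + 1) * h)" using \<rho> by (intro mult_left_mono exp_ge_add_one_self) auto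
      also have "\<dots> = \<epsilon> * exp ((L + 1) * (c + h))" by (simp add: \<rho>_def algebra_simps flip: exp_add)
      finally have "c + h \<in> A" using h c by (simp add: A_def)
      then have "c + h \<le> c" unfolding c_def using bdd by (rule cSup_upper)
      then show False using h by simp
    qed
    then show ?thesis using cA by (simp add: A_def c_def)
  qed
  have "infdist (x b) K \<le> 0"
  proof (rule field_le_epsilon)
    fix e :: real assume "e > 0"
    then show "infdist (x b) K \<le> 0 + e" using main[of "e / exp ((L + 1) * b)"] by simp
  qed
  then have "infdist (x b) K = 0" using infdist_nonneg[of "x b" K] by linarith
  then show ?thesis using in_closed_iff_infdist_zero[OF assms(1) K] by simp
qed

section \<open>Global trajectories and the inverse flow map\<close>

locale lipschitz_field =
  fixes V :: "real \<Rightarrow> 'a::euclidean_space \<Rightarrow> 'a" and L :: real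
  assumes V_cont: "continuous_on ({0..} \<times> UNIV) (\<lambda>(t, x). V t x)"
    and V_lip: "t \<ge> 0 \<Longrightarrow> norm (V t x - V t y) \<le> L * norm (x - y)"
    and L_nonneg: "L \<ge> 0"
begin

definition curve :: "(real \<Rightarrow> 'a) \<Rightarrow> bool" where
  "curve x \<longleftrightarrow> (\<forall>s\<ge>0. (x has_vector_derivative V s (x s)) (at s within {0..}))"

lemma curve_interval:
  "curve x \<Longrightarrow> 0 \<le> a \<Longrightarrow> s \<in> {a..b} \<Longrightarrow> (x has_vector_derivative V s (x s)) (at s within {a..b})"
  unfolding curve_def by (rule has_vector_derivative_within_subset[of _ _ _ "{0..}"]) auto

lemma solutions_dist:
  assumes "a \<le> b" "0 \<le> a" "s \<in> {a, b}" "t \<in> {a, b}"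
    and "\<And>s. s \<in> {a..b} \<Longrightarrow> (x has_vector_derivative V s (x s)) (at s within {a..b})"
    and "\<And>s. s \<in> {a..b} \<Longrightarrow> (y has_vector_derivative V s (y s)) (at s within {a..b})"
  shows "norm (x s - y s) \<le> exp (L * \<bar>s - t\<bar>) * norm (x t - y t)"
proof -
  have lip: "norm (V s (x s) - V s (y s)) \<le> L * norm (x s - y s)" if "s \<in> {a..b}" for s
    using V_lip[of s "x s" "y s"] that assms(2) by auto
  show ?thesis
    using gronwall_forward[OF assms(1,5,6) lip] gronwall_backward[OF assms(1,5,6) lip] assms(1,3,4) by auto
qed

lemma curve_dist:
  assumes "curve x" "curve y" "0 \<le> s" "0 \<le> t"
  shows "norm (x s - y s) \<le> exp (L * \<bar>s - t\<bar>) * norm (x t - y t)"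
  using solutions_dist[of "min s t" "max s t" s t x y] curve_interval[of _ "min s t" _ "max s t"] assms
  by (auto simp: min_def max_def)

text \<open>\<open>V\<close> may be unbounded in time, while the existence lemma asks for a bound at
  \<open>\<xi>\<close>. Hence the time argument is clamped to \<open>{0..T}\<close>, and the
  solutions for different horizons, which agree by uniqueness, are pasted together.\<close>

lemma curve_exists:
  assumes "\<tau> \<ge> 0"
  obtains x where "curve x" "x \<tau> = \<xi>"
proof -
  have "\<exists>x. x \<tau> = \<xi> \<and> (\<forall>s\<in>{0..T}. (x has_vector_derivative V s (x s)) (at s))" if "T \<ge> 0" for T
  proof -
    define k where "k = (\<lambda>s. max 0 (min T s))"
    have k: "k s \<in> {0..T}" "s \<in> {0..T} \<Longrightarrow> k s = s" for s using that by (auto simp: k_def)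
    have cont_k: "continuous_on A k" for A unfolding k_def by (intro continuous_intros)
    have cont: "continuous_on UNIV (\<lambda>(s, x). V (k s) x)"
    proof -
      have "continuous_on UNIV (\<lambda>w. (\<lambda>(t, x). V t x) (k (fst w), snd w))"
        by (intro continuous_on_compose2[OF V_cont] continuous_on_Pair continuous_on_compose2[OF cont_k]
            continuous_on_fst continuous_on_snd continuous_on_id) (use k in auto)
      then show ?thesis by (simp add: case_prod_beta)
    qed
    have "compact ((\<lambda>t. V t \<xi>) ` {0..T})"
    proof (rule compact_continuous_image)
      have "continuous_on {0..T} (\<lambda>t. (\<lambda>(t, x). V t x) (t, \<xi>))"
        by (intro continuous_on_compose2[OF V_cont] continuous_intros) auto
      then show "continuous_on {0..T} (\<lambda>t. V t \<xi>)" by simp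
    qed simp
    then obtain B where B: "\<And>t. t \<in> {0..T} \<Longrightarrow> norm (V t \<xi>) \<le> B"
      by (meson bounded_iff compact_imp_bounded imageI)
    obtain x where "x \<tau> = \<xi>" "\<And>s. (x has_vector_derivative V (k s) (x s)) (at s)"
    proof (rule global_lipschitz_ode[OF cont])
      show "norm (V (k s) x - V (k s) y) \<le> L * norm (x - y)" for s x y using V_lip k(1)[of s] by auto
      show "norm (V (k s) \<xi>) \<le> B" for s using B k(1) .
    qed blast
    then show ?thesis using k(2) by metis
  qed
  then obtain X where X: "\<And>T. T \<ge> 0 \<Longrightarrow> X T \<tau> = \<xi>"
      "\<And>T s. T \<ge> 0 \<Longrightarrow> s \<in> {0..T} \<Longrightarrow> (X T has_vector_derivative V s (X T s)) (at s)"
    by metis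
  have eq: "X T s = X T' s" if "\<tau> \<le> T" "T \<le> T'" "s \<in> {0..T}" for T T' s
  proof -
    have "norm (X T s - X T' s) \<le> exp (L * \<bar>s - \<tau>\<bar>) * norm (X T \<tau> - X T' \<tau>)"
    proof (rule solutions_dist[of "min s \<tau>" "max s \<tau>"])
      fix r assume r: "r \<in> {min s \<tau>..max s \<tau>}"
      then have "r \<in> {0..T}" "r \<in> {0..T'}" "T \<ge> 0" "T' \<ge> 0" using that assms by auto
      then show "(X T has_vector_derivative V r (X T r)) (at r within {min s \<tau>..max s \<tau>})"
          "(X T' has_vector_derivative V r (X T' r)) (at r within {min s \<tau>..max s \<tau>})"
        by (blast intro: has_vector_derivative_at_within X(2))+
    qed (use that assms in \<open>auto simp: min_def max_def\<close>)
    then show ?thesis using X(1) that assms by simp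
  qed
  \<comment> \<open>The horizon exceeds both \<open>\<tau>\<close> and \<open>s\<close>. For the
    derivative at \<open>s\<close> the horizon with \<open>+ 2\<close> is used, since it covers all
    \<open>r\<close> at distance below 1 from \<open>s\<close> at once.\<close>
  define x where "x = (\<lambda>s. X (max \<tau> s + 1) s)"
  have "(x has_vector_derivative V s (x s)) (at s within {0..})" if s: "s \<ge> 0" for s
  proof -
    have d: "(X (max \<tau> s + 2) has_vector_derivative V s (X (max \<tau> s + 2) s)) (at s within {0..})"
      by (rule has_vector_derivative_at_within, rule X(2)) (use s assms in auto)
    have x_eq: "X (max \<tau> s + 2) r = x r" if "r \<in> {0..}" "dist r s < 1" for r
    proof -
      have "max \<tau> r + 1 \<le> max \<tau> s + 2" using that by (auto simp: dist_real_def max_def)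
      then show ?thesis using eq[of "max \<tau> r + 1" "max \<tau> s + 2" r] that unfolding x_def by auto
    qed
    have "s \<in> {0..}" "X (max \<tau> s + 2) s = x s" using x_eq[of s] s by simp_all
    then show ?thesis
      using has_vector_derivative_transform_within[OF d zero_less_one _ x_eq] by metis
  qed
  then have "curve x" by (simp add: curve_def)
  moreover have "x \<tau> = \<xi>" using X(1) assms by (simp add: x_def)
  ultimately show thesis by (rule that)
qed

text \<open>In flow notation this is X(0,t,x). For \<open>t \<ge> 0\<close> the chosen curve is
  immaterial, as curves that agree at time \<open>t\<close> agree at time 0.\<close>

definition origin :: "real \<Rightarrow> 'a \<Rightarrow> 'a" where
  "origin t x = (SOME c. curve c \<and> c t = x) 0"

lemma origin_curve:
  assumes "curve c" "t \<ge> 0"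
  shows "origin t (c t) = c 0"
proof -
  define d where "d = (SOME d. curve d \<and> d t = c t)"
  have "\<exists>d. curve d \<and> d t = c t" using assms(1) by blast
  then have "curve d \<and> d t = c t" unfolding d_def by (rule someI_ex)
  then have "norm (d 0 - c 0) \<le> 0" using curve_dist[of d c 0 t] assms by simp
  then show ?thesis by (simp add: origin_def flip: d_def)
qed

lemma origin_0: "origin 0 x = x"
  using curve_exists[of 0 x] origin_curve[of _ 0] by (metis order_refl)

lemma origin_dist:
  assumes "t \<ge> 0"
  shows "norm (origin t x - origin t y) \<le> exp (L * t) * norm (x - y)"
proof -
  obtain c where c: "curve c" "c t = x" using curve_exists[OF assms] by metis
  obtain d where d: "curve d" "d t = y" using curve_exists[OF assms] by metis
  show ?thesis
    using curve_dist[OF c(1) d(1) order_refl assms] origin_curve[OF c(1) assms] origin_curve[OF d(1) assms]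
      assms c d by simp
qed

text \<open>All points of the curve \<open>c\<close> through \<open>(t, x)\<close> have the same
  origin \<open>c 0\<close>. So the origin of a nearby \<open>(s, y)\<close> is compared with that
  of \<open>(s, c s)\<close>, at the same time \<open>s\<close>, which gives the bound
  \<open>exp (L * s) * norm (y - c s)\<close>.\<close>

lemma continuous_on_origin: "continuous_on ({0..} \<times> UNIV) (\<lambda>(t, x). origin t x)"
  unfolding continuous_on_def
proof (intro ballI)
  fix z :: "real \<times> 'a" assume z: "z \<in> {0..} \<times> UNIV"
  obtain t x where tx: "z = (t, x)" "t \<ge> 0" using z by auto
  obtain c where c: "curve c" "c t = x" using curve_exists[OF tx(2)] by metis
  let ?F = "at z within {0..} \<times> UNIV"
  have fst_lim: "(fst \<longlongrightarrow> t) ?F" and snd_lim: "(snd \<longlongrightarrow> x) ?F"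
    using tendsto_fst[OF tendsto_ident_at, of z] tendsto_snd[OF tendsto_ident_at, of z] tx(1) by simp_all
  have cont_c: "continuous_on {0..} c"
    using c(1) unfolding curve_def continuous_on_eq_continuous_within
    by (auto intro: has_vector_derivative_continuous)
  have c_lim: "((\<lambda>w. c (fst w)) \<longlongrightarrow> c t) ?F"
    by (rule continuous_on_tendsto_compose[OF cont_c fst_lim])
      (use tx in \<open>auto simp: eventually_at_topological\<close>)
  have "((\<lambda>w. exp (L * fst w) * norm (snd w - c (fst w))) \<longlongrightarrow> exp (L * t) * norm (x - c t)) ?F"
    by (intro tendsto_intros fst_lim snd_lim c_lim)
  then have lim0: "((\<lambda>w. exp (L * fst w) * norm (snd w - c (fst w))) \<longlongrightarrow> 0) ?F" using c by simp
  have "((\<lambda>w. (\<lambda>(t, x). origin t x) w - c 0) \<longlongrightarrow> 0) ?F"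
  proof (rule Lim_null_comparison[OF _ lim0])
    have "norm ((\<lambda>(t, x). origin t x) w - c 0) \<le> exp (L * fst w) * norm (snd w - c (fst w))"
      if "w \<in> {0..} \<times> UNIV" for w
      using origin_dist[of "fst w" "snd w" "c (fst w)"] origin_curve[OF c(1), of "fst w"] that by auto
    then show "\<forall>\<^sub>F w in ?F. norm ((\<lambda>(t, x). origin t x) w - c 0) \<le> exp (L * fst w) * norm (snd w - c (fst w))"
      unfolding eventually_at_topological by blast
  qed
  then have "((\<lambda>(t, x). origin t x) \<longlongrightarrow> c 0) ?F" by (rule LIM_zero_cancel)
  then show "((\<lambda>(t, x). origin t x) \<longlongrightarrow> (\<lambda>(t, x). origin t x) z) ?F"
    using origin_curve[OF c(1) tx(2)] c(2) tx(1) by simp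
qed

context
  fixes K :: "'a set"
  assumes closed_K: "closed K"
    and tangent: "\<And>s y. s \<ge> 0 \<Longrightarrow> y \<in> K \<Longrightarrow> V s y \<in> bouligand_cone K y \<and> - V s y \<in> bouligand_cone K y"
begin

lemma curve_invariant_forward:
  assumes "curve c" "c s \<in> K" "0 \<le> s" "s \<le> t"
  shows "c t \<in> K"
proof -
  have "(\<lambda>r. c (s + r)) (t - s) \<in> K"
  proof (rule nagumo[OF closed_K, where x = "\<lambda>r. c (s + r)" and b = "t - s" and F = "\<lambda>r. V (s + r)" and L = L])
    fix r assume r: "r \<in> {0..t - s}"
    have "((\<lambda>r. s + r) has_vector_derivative 0 + 1) (at r within {0..t - s})"
      by (intro has_vector_derivative_add has_vector_derivative_const has_vector_derivative_id)
    moreover have "(\<lambda>r. s + r) ` {0..t - s} = {s..t}" by simp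
    moreover have "(c has_vector_derivative V (s + r) (c (s + r))) (at (s + r) within {s..t})"
      using curve_interval[OF assms(1,3), of "s + r" t] r by simp
    ultimately show "((\<lambda>r. c (s + r)) has_vector_derivative V (s + r) (c (s + r))) (at r within {0..t - s})"
      using vector_diff_chain_within[of "\<lambda>r. s + r" 1 r "{0..t - s}" c] by (simp add: o_def)
  qed (use assms L_nonneg V_lip tangent in auto)
  then show ?thesis by simp
qed

lemma curve_invariant_backward:
  assumes "curve c" "c t \<in> K" "0 \<le> s" "s \<le> t"
  shows "c s \<in> K"
proof -
  have "(\<lambda>r. c (t - r)) (t - s) \<in> K"
  proof (rule nagumo[OF closed_K, where x = "\<lambda>r. c (t - r)" and b = "t - s" and F = "\<lambda>r x. - V (t - r) x" and L = L])
    fix r assume r: "r \<in> {0..t - s}"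
    have "((\<lambda>r. c (t - r)) has_vector_derivative - V (t - r) (c (t - r))) (at r within {t - t..t - s})"
      by (rule has_vector_derivative_reverse, rule curve_interval) (use r assms in auto)
    then show "((\<lambda>r. c (t - r)) has_vector_derivative - V (t - r) (c (t - r))) (at r within {0..t - s})"
      by simp
    show "norm (- V (t - r) p - (- V (t - r) q)) \<le> L * norm (p - q)" for p q
      using V_lip[of "t - r" q p] r assms(3) by (simp add: norm_minus_commute)
  qed (use assms L_nonneg tangent in auto)
  then show ?thesis by simp
qed

lemma curve_invariant: "curve c \<Longrightarrow> c s \<in> K \<Longrightarrow> 0 \<le> s \<Longrightarrow> 0 \<le> t \<Longrightarrow> c t \<in> K"
  using curve_invariant_forward curve_invariant_backward by (metis linear)

end

text \<open>A curve that leaves \<open>\<Omega>\<close> meets the frontier by connectedness, and the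
  frontier is invariant in both directions of time.\<close>

lemma curve_invariant_open:
  assumes "open \<Omega>"
    and "\<And>s y. s \<ge> 0 \<Longrightarrow> y \<in> frontier \<Omega> \<Longrightarrow>
      V s y \<in> bouligand_cone (frontier \<Omega>) y \<and> - V s y \<in> bouligand_cone (frontier \<Omega>) y"
    and "curve c" "c s \<in> \<Omega>" "0 \<le> s" "0 \<le> t"
  shows "c t \<in> \<Omega>"
proof (rule ccontr)
  assume "c t \<notin> \<Omega>"
  have "continuous_on {0..} c"
    using assms(3) unfolding curve_def continuous_on_eq_continuous_within
    by (auto intro: has_vector_derivative_continuous)
  then have "connected (c ` {0..})" by (intro connected_continuous_image) auto
  then have "c ` {0..} \<inter> frontier \<Omega> \<noteq> {}"
    by (rule connected_Int_frontier) (use assms \<open>c t \<notin> \<Omega>\<close> in auto)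
  then obtain r where "r \<ge> 0" "c r \<in> frontier \<Omega>" by auto
  then have "c s \<in> frontier \<Omega>"
    using curve_invariant[OF frontier_closed assms(2) assms(3), of r s] assms(5) by blast
  then show False using assms(1,4) by (simp add: frontier_def interior_open)
qed

end

section \<open>Viscosity solutions of odd equations\<close>

lemma tendsto_SUP_cball:
  assumes "continuous_on Q u" "z \<in> Q"
  shows "((\<lambda>r. SUP y\<in>Q \<inter> cball z r. u y :: real) \<longlongrightarrow> u z) (at_right 0)"
  unfolding tendsto_iff
proof (intro allI impI)
  fix e :: real assume e: "e > 0"
  obtain d where d: "d > 0" "\<And>y. y \<in> Q \<Longrightarrow> dist y z < d \<Longrightarrow> dist (u y) (u z) < e / 2"
    using assms e unfolding continuous_on_iff by (meson half_gt_zero)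
  have "dist (SUP y\<in>Q \<inter> cball z r. u y) (u z) < e" if r: "0 < r" "r < d" for r
  proof -
    have le: "u y \<le> u z + e / 2" if "y \<in> Q \<inter> cball z r" for y
    proof -
      have "dist (u y) (u z) < e / 2" using d(2)[of y] that r by (auto simp: dist_commute)
      then show ?thesis unfolding dist_real_def by linarith
    qed
    have zin: "z \<in> Q \<inter> cball z r" using assms(2) r by auto
    have "(SUP y\<in>Q \<inter> cball z r. u y) \<le> u z + e / 2" using zin le by (intro cSUP_least) auto
    moreover have "u z \<le> (SUP y\<in>Q \<inter> cball z r. u y)"
      using le by (intro cSUP_upper zin bdd_aboveI2[of _ _ "u z + e / 2"])
    ultimately show ?thesis using e by (simp add: dist_real_def)
  qed
  then show "\<forall>\<^sub>F r in at_right 0. dist (SUP y\<in>Q \<inter> cball z r. u y) (u z) < e"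
    unfolding eventually_at_right_field using d(1) by blast
qed

lemma usc_env_eq: "continuous_on Q u \<Longrightarrow> z \<in> Q \<Longrightarrow> usc_env Q u z = u z"
  unfolding usc_env_def by (intro tendsto_Lim tendsto_SUP_cball) auto

lemma lsc_env_eq:
  assumes "continuous_on Q u" "z \<in> Q"
  shows "lsc_env Q u z = u z"
proof -
  have "((\<lambda>r. - (SUP y\<in>Q \<inter> cball z r. - u y)) \<longlongrightarrow> - (- u z)) (at_right 0)"
    by (intro tendsto_minus tendsto_SUP_cball continuous_on_minus assms)
  then show ?thesis
    unfolding lsc_env_def Inf_real_def image_image by (intro tendsto_Lim) auto
qed

text \<open>Riesz representation of the derivative, written out in the basis so that the gradient
  inherits continuity from it.\<close>

lemma C1_on_gradient:
  fixes Q :: "'a::euclidean_space set" and \<phi> :: "'a \<Rightarrow> real"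
  assumes "open Q" "C1_on Q \<phi>"
  obtains G where "\<And>y. y \<in> Q \<Longrightarrow> GDERIV \<phi> y :> G y" "continuous_on Q G"
proof -
  obtain f' where f': "\<And>z. z \<in> Q \<Longrightarrow> (\<phi> has_derivative blinfun_apply (f' z)) (at z within Q)" "continuous_on Q f'"
    using assms(2) unfolding C1_on_def by blast
  define G where "G = (\<lambda>y. \<Sum>b\<in>Basis. f' y b *\<^sub>R b)"
  have inner_G: "v \<bullet> G y = f' y v" for y v
  proof -
    have "f' y v = f' y (\<Sum>b\<in>Basis. (v \<bullet> b) *\<^sub>R b)" by (simp add: euclidean_representation)
    also have "\<dots> = v \<bullet> G y"
      by (simp add: G_def blinfun.sum_right blinfun.scaleR_right inner_sum_right mult.commute)
    finally show ?thesis ..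
  qed
  show thesis
  proof
    show "GDERIV \<phi> y :> G y" if "y \<in> Q" for y
      using f'(1)[OF that] at_within_open[OF that assms(1)] by (simp add: gderiv_def inner_G)
    show "continuous_on Q G" unfolding G_def by (intro continuous_intros f'(2))
  qed
qed

lemma gradient_C1_on:
  fixes Q :: "'a::real_inner set" and \<phi> :: "'a \<Rightarrow> real"
  assumes "\<And>y. y \<in> Q \<Longrightarrow> GDERIV \<phi> y :> G y" "continuous_on Q G"
  shows "C1_on Q \<phi>"
  unfolding C1_on_def
proof (intro exI conjI ballI)
  show "continuous_on Q (\<lambda>y. blinfun_inner_left (G y))"
    by (intro bounded_linear.continuous_on[OF bounded_linear_blinfun_inner_left] assms)
  show "(\<phi> has_derivative blinfun_apply (blinfun_inner_left (G y))) (at y within Q)" if "y \<in> Q" for y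
    using assms(1)[OF that] unfolding gderiv_def by (simp add: has_derivative_at_withinI)
qed

lemma local_min_at_iff:
  assumes "\<And>y. y \<in> Q \<Longrightarrow> f y = - g y" "z \<in> Q"
  shows "local_min_at Q f z \<longleftrightarrow> local_max_at Q g z"
  unfolding local_max_at_def local_min_at_def using assms by (intro ex_cong1 conj_cong ball_cong) auto

lemma visc_sub_of_subsolution:
  assumes "continuous_on Q u" "viscosity_subsolution Q H u"
  shows "visc_sub Q H u"
  unfolding visc_sub_def
proof (intro allI impI, elim conjE)
  fix \<phi> G z
  assume G: "\<forall>y\<in>Q. GDERIV \<phi> y :> G y" "continuous_on Q G" and z: "z \<in> Q"
    and max: "local_max_at Q (\<lambda>y. u y - \<phi> y) z"
  have "C1_on Q \<phi>" by (rule gradient_C1_on) (use G in auto)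
  moreover have "local_max_at Q (\<lambda>y. usc_env Q u y - \<phi> y) z"
    using max local_max_at_cong[of Q "\<lambda>y. usc_env Q u y - \<phi> y" "\<lambda>y. u y - \<phi> y" z]
      usc_env_eq[OF assms(1)] z by simp
  ultimately show "H z (u z) (G z) \<le> 0"
    using assms(2) z G(1) usc_env_eq[OF assms(1) z] unfolding viscosity_subsolution_def by metis
qed

text \<open>Negating the test function turns a maximum of \<open>- u - \<phi>\<close> into a minimum
  of \<open>u + \<phi>\<close>, and oddness reverses the inequality.\<close>

lemma visc_sub_of_supersolution:
  assumes "continuous_on Q u" "viscosity_supersolution Q H u"
    and odd: "\<And>z a q. z \<in> Q \<Longrightarrow> H z (- a) (- q) = - H z a q"
  shows "visc_sub Q H (\<lambda>z. - u z)"
  unfolding visc_sub_def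
proof (intro allI impI, elim conjE)
  fix \<phi> G z
  assume G: "\<forall>y\<in>Q. GDERIV \<phi> y :> G y" "continuous_on Q G" and z: "z \<in> Q"
    and max: "local_max_at Q (\<lambda>y. - u y - \<phi> y) z"
  have D: "GDERIV (\<lambda>y. - \<phi> y) y :> - G y" if "y \<in> Q" for y
    using G(1) that GDERIV_minus by blast
  have "C1_on Q (\<lambda>y. - \<phi> y)" by (rule gradient_C1_on[OF D]) (auto intro!: continuous_intros G(2))
  moreover have "local_min_at Q (\<lambda>y. lsc_env Q u y - (- \<phi> y)) z"
    using max local_min_at_iff[of Q "\<lambda>y. lsc_env Q u y - (- \<phi> y)" "\<lambda>y. - u y - \<phi> y" z]
      lsc_env_eq[OF assms(1)] z by simp
  ultimately have "H z (lsc_env Q u z) (- G z) \<ge> 0"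
    using assms(2) z D[OF z] unfolding viscosity_supersolution_def by blast
  then show "H z (- u z) (G z) \<le> 0"
    using odd[OF z, of "- u z" "G z"] lsc_env_eq[OF assms(1) z] by simp
qed

lemma bounded_imp_locally_bounded_on:
  assumes "\<And>z. z \<in> Q \<Longrightarrow> \<bar>u z\<bar> \<le> M"
  shows "locally_bounded_on Q u"
  unfolding locally_bounded_on_def
proof
  fix z assume "z \<in> Q"
  have "bounded (u ` (Q \<inter> cball z 1))"
    by (rule boundedI[of _ M]) (use assms in auto)
  then show "\<exists>r>0. bounded (u ` (Q \<inter> cball z r))" using zero_less_one by blast
qed

lemma GDERIV_unique:
  assumes "GDERIV f z :> p" "GDERIV f z :> q"
  shows "p = q"
proof -
  have "(\<lambda>h. h \<bullet> p) = (\<lambda>h. h \<bullet> q)"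
    using assms unfolding gderiv_def by (rule has_derivative_unique)
  then have "(p - q) \<bullet> p = (p - q) \<bullet> q" by meson
  then show ?thesis by (metis inner_diff_right inner_eq_zero_iff right_minus_eq)
qed

lemma subsolution_of_visc_sub:
  assumes "open Q" "continuous_on Q u" "\<And>z. z \<in> Q \<Longrightarrow> \<bar>u z\<bar> \<le> M" "visc_sub Q H u"
  shows "viscosity_subsolution Q H u"
  unfolding viscosity_subsolution_def
proof (intro conjI allI impI)
  show "locally_bounded_on Q u" using assms(3) by (rule bounded_imp_locally_bounded_on)
  show "bdd_above (usc_env Q u ` Q)"
    by (rule bdd_aboveI2[of _ _ M]) (use assms(3) usc_env_eq[OF assms(2)] in fastforce)
  fix \<phi> z p
  assume *: "C1_on Q \<phi> \<and> z \<in> Q \<and> local_max_at Q (\<lambda>y. usc_env Q u y - \<phi> y) z \<and> GDERIV \<phi> z :> p"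
  then obtain G where G: "\<And>y. y \<in> Q \<Longrightarrow> GDERIV \<phi> y :> G y" "continuous_on Q G"
    using C1_on_gradient[OF assms(1)] by metis
  have "local_max_at Q (\<lambda>y. u y - \<phi> y) z"
    using * local_max_at_cong[of Q "\<lambda>y. usc_env Q u y - \<phi> y" "\<lambda>y. u y - \<phi> y" z] usc_env_eq[OF assms(2)]
    by simp
  then have "H z (u z) (G z) \<le> 0" using assms(4) G * unfolding visc_sub_def by blast
  then show "H z (usc_env Q u z) p \<le> 0"
    using * G(1)[of z] GDERIV_unique[of \<phi> z p "G z"] usc_env_eq[OF assms(2), of z] by simp
qed

lemma supersolution_of_visc_sub:
  assumes "open Q" "continuous_on Q u" "\<And>z. z \<in> Q \<Longrightarrow> \<bar>u z\<bar> \<le> M" "visc_sub Q H (\<lambda>z. - u z)"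
    and odd: "\<And>z a q. z \<in> Q \<Longrightarrow> H z (- a) (- q) = - H z a q"
  shows "viscosity_supersolution Q H u"
  unfolding viscosity_supersolution_def
proof (intro conjI allI impI)
  show "locally_bounded_on Q u" using assms(3) by (rule bounded_imp_locally_bounded_on)
  show "bdd_below (lsc_env Q u ` Q)"
    by (rule bdd_belowI2[of _ "- M"]) (use assms(3) lsc_env_eq[OF assms(2)] in fastforce)
  fix \<phi> z p
  assume *: "C1_on Q \<phi> \<and> z \<in> Q \<and> local_min_at Q (\<lambda>y. lsc_env Q u y - \<phi> y) z \<and> GDERIV \<phi> z :> p"
  then obtain G where G: "\<And>y. y \<in> Q \<Longrightarrow> GDERIV \<phi> y :> G y" "continuous_on Q G"
    using C1_on_gradient[OF assms(1)] by metis
  have "GDERIV (\<lambda>y. - \<phi> y) y :> - G y" if "y \<in> Q" for y using G(1)[OF that] GDERIV_minus by blast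
  moreover have "continuous_on Q (\<lambda>y. - G y)" by (intro continuous_intros G)
  moreover have "local_max_at Q (\<lambda>y. - u y - (- \<phi> y)) z"
    using * local_min_at_iff[of Q "\<lambda>y. lsc_env Q u y - \<phi> y" "\<lambda>y. - u y - (- \<phi> y)" z]
      lsc_env_eq[OF assms(2)] by simp
  ultimately have "H z (- u z) (- G z) \<le> 0"
    using * assms(4)[unfolded visc_sub_def, rule_format, of "\<lambda>y. - \<phi> y" "\<lambda>y. - G y" z] by blast
  then show "H z (lsc_env Q u z) p \<ge> 0"
    using * G(1)[of z] GDERIV_unique[of \<phi> z p "G z"] lsc_env_eq[OF assms(2), of z] odd[of z "u z" "G z"]
    by simp
qed

section \<open>Barriers and the Dirichlet problem\<close>

text \<open>Outside \<open>Q\<close> semicontinuity comes from \<open>g\<close>, which dominates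
  \<open>u\<close>. This is how the barriers hand their boundary values on to Perron's function and
  to its envelope.\<close>

lemma usc_on_extend:
  assumes "open Q" "Q \<subseteq> E" "usc_on Q u" "usc_on E g" "\<And>z. z \<in> Q \<Longrightarrow> u z \<le> g z"
  shows "usc_on E (\<lambda>z. if z \<in> Q then u z else g z)"
  unfolding usc_on_def
proof (intro ballI allI impI)
  fix z c assume z: "z \<in> E" and c: "(if z \<in> Q then u z else g z) < c"
  show "\<exists>e>0. \<forall>y\<in>E \<inter> ball z e. (if y \<in> Q then u y else g y) < c"
  proof (cases "z \<in> Q")
    case True
    obtain e1 where e1: "e1 > 0" "ball z e1 \<subseteq> Q" using assms(1) True open_contains_ball by blast
    obtain e2 where e2: "e2 > 0" "\<And>y. y \<in> Q \<Longrightarrow> dist z y < e2 \<Longrightarrow> u y < c"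
      using usc_onD[OF assms(3) True, of c] c True by auto
    show ?thesis
      by (intro exI[of _ "min e1 e2"]) (use e1 e2 in auto)
  next
    case False
    obtain e where e: "e > 0" "\<And>y. y \<in> E \<Longrightarrow> dist z y < e \<Longrightarrow> g y < c"
      using usc_onD[OF assms(4) z, of c] c False by auto
    have "(if y \<in> Q then u y else g y) < c" if "y \<in> E \<inter> ball z e" for y
      using e(2)[of y] assms(5)[of y] that by auto
    with e(1) show ?thesis by blast
  qed
qed

lemma usc_on_both_continuous:
  assumes "usc_on E f" "usc_on E (\<lambda>z. - f z)"
  shows "continuous_on E f"
  unfolding continuous_on_iff
proof (intro ballI allI impI)
  fix z and e :: real assume z: "z \<in> E" and e: "0 < e"
  obtain d1 where d1: "d1 > 0" "\<And>y. y \<in> E \<Longrightarrow> dist z y < d1 \<Longrightarrow> f y < f z + e"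
    using usc_onD[OF assms(1) z, of "f z + e"] e by auto
  obtain d2 where d2: "d2 > 0" "\<And>y. y \<in> E \<Longrightarrow> dist z y < d2 \<Longrightarrow> - f y < - f z + e"
    using usc_onD[OF assms(2) z, of "- f z + e"] e by auto
  have "dist (f y) (f z) < e" if "y \<in> E" "dist y z < min d1 d2" for y
    using d1(2)[of y] d2(2)[of y] that by (auto simp: dist_real_def dist_commute)
  with d1 d2 show "\<exists>d>0. \<forall>y\<in>E. dist y z < d \<longrightarrow> dist (f y) (f z) < e"
    by (intro exI[of _ "min d1 d2"]) auto
qed

text \<open>\<open>h_value_0\<close> ties the Hamiltonian to the field: together with
  \<open>h_lip\<close> it differs from pure transport by at most \<open>L * \<bar>a\<bar>\<close>.
  \<open>h_gradient_0\<close> makes constants solutions, which permits the truncation of the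
  barriers.\<close>

locale transport_hamiltonian = hamiltonian h L \<Omega> + lipschitz_field V L
  for h :: "real \<Rightarrow> 'a::euclidean_space \<Rightarrow> real \<Rightarrow> 'a \<Rightarrow> real" and L :: real and \<Omega> :: "'a set"
    and V :: "real \<Rightarrow> 'a \<Rightarrow> 'a" +
  assumes h_value_0: "t \<ge> 0 \<Longrightarrow> h t x 0 p = V t x \<bullet> p"
    and h_gradient_0: "t \<ge> 0 \<Longrightarrow> h t x a 0 = 0"
    and tangent: "\<And>s y. s \<ge> 0 \<Longrightarrow> y \<in> frontier \<Omega> \<Longrightarrow>
      V s y \<in> bouligand_cone (frontier \<Omega>) y \<and> - V s y \<in> bouligand_cone (frontier \<Omega>) y"
begin

lemma h_le_transport: "t \<ge> 0 \<Longrightarrow> h t x a p \<le> V t x \<bullet> p + L * \<bar>a\<bar>"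
  using h_lip[of t x a p x 0] h_value_0[of t x p] by simp

lemma curve_in_dom: "curve c \<Longrightarrow> c s \<in> \<Omega> \<Longrightarrow> 0 \<le> s \<Longrightarrow> 0 \<le> t \<Longrightarrow> c t \<in> \<Omega>"
  using curve_invariant_open[OF open_dom tangent] by blast

lemma curve_in_frontier: "curve c \<Longrightarrow> c s \<in> frontier \<Omega> \<Longrightarrow> 0 \<le> s \<Longrightarrow> 0 \<le> t \<Longrightarrow> c t \<in> frontier \<Omega>"
  using curve_invariant[OF frontier_closed tangent] by blast

lemma curve_in_closure: "curve c \<Longrightarrow> c s \<in> closure \<Omega> \<Longrightarrow> 0 \<le> s \<Longrightarrow> 0 \<le> t \<Longrightarrow> c t \<in> closure \<Omega>"
  using curve_in_dom curve_in_frontier unfolding closure_Un_frontier by blast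

lemma origin_in_closure: "t \<ge> 0 \<Longrightarrow> x \<in> closure \<Omega> \<Longrightarrow> origin t x \<in> closure \<Omega>"
  using curve_exists[of t x] origin_curve curve_in_closure by (metis order_refl)

lemma origin_in_frontier: "t \<ge> 0 \<Longrightarrow> x \<in> frontier \<Omega> \<Longrightarrow> origin t x \<in> frontier \<Omega>"
  using curve_exists[of t x] origin_curve curve_in_frontier by (metis order_refl)

definition barrier :: "('a \<Rightarrow> real) \<Rightarrow> real \<times> 'a \<Rightarrow> real" where
  "barrier k = (\<lambda>(t, x). exp (- L * t) * max 0 (k (origin t x)) + exp (L * t) * min 0 (k (origin t x)))"

lemma barrier_le: "0 \<le> t \<Longrightarrow> barrier k (t, x) \<le> k (origin t x)"
proof -
  assume t: "0 \<le> t"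
  define a where "a = k (origin t x)"
  have "exp (- L * t) \<le> 1" "1 \<le> exp (L * t)" using t L_nonneg by auto
  then have "exp (- L * t) * max 0 a \<le> 1 * max 0 a" "exp (L * t) * min 0 a \<le> 1 * min 0 a"
    by (intro mult_right_mono mult_right_mono_neg; simp)+
  moreover have "max 0 a + min 0 a = a" by (simp add: max_def min_def)
  ultimately show ?thesis unfolding barrier_def prod.case a_def[symmetric] by linarith
qed

lemma barrier_0: "barrier k (0, x) = k x"
  by (simp add: barrier_def origin_0 max_def min_def)

lemma continuous_on_barrier:
  assumes "continuous_on (closure \<Omega>) k"
  shows "continuous_on E (barrier k)"
proof -
  have "continuous_on E (\<lambda>w. (\<lambda>(t, x). origin t x) w)"
    by (rule continuous_on_subset[OF continuous_on_origin]) auto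
  then have "continuous_on E (\<lambda>w. k ((\<lambda>(t, x). origin t x) w))"
    by (rule continuous_on_compose2[OF assms]) (use origin_in_closure in auto)
  then have k: "continuous_on E (\<lambda>w. k (origin (fst w) (snd w)))" by (simp add: case_prod_beta)
  show ?thesis
    unfolding barrier_def case_prod_beta by (intro continuous_intros k)
qed

text \<open>Along a trajectory the barrier has slope \<open>- L \<bar>barrier\<bar>\<close>, which compensates the deviation of
  the Hamiltonian from the transport term.\<close>

lemma visc_sub_barrier: "visc_sub Q H (barrier k)"
  unfolding visc_sub_def
proof (intro allI impI, elim conjE)
  fix \<phi> G z
  assume G: "\<forall>y\<in>Q. GDERIV \<phi> y :> G y" "continuous_on Q G" and z: "z \<in> Q"
    and "local_max_at Q (\<lambda>y. barrier k y - \<phi> y) z"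
  then obtain e where e: "e > 0" "\<And>y. y \<in> Q \<Longrightarrow> dist z y < e \<Longrightarrow> barrier k y - \<phi> y \<le> barrier k z - \<phi> z"
    unfolding local_max_at_def by auto
  obtain t x where tx: "z = (t, x)" "t > 0" "x \<in> \<Omega>" using z by auto
  obtain q p where qp: "G z = (q, p)" by force
  obtain c where c: "curve c" "c t = x" using curve_exists[of t x] tx(2) by auto
  define a where "a = k (c 0)"
  \<comment> \<open>The barrier along the trajectory through \<open>(t, x)\<close>. The initial
    function enters only through the constant \<open>a\<close>, so this restriction is
    differentiable although nothing is known about derivatives of \<open>k\<close> or
    \<open>origin\<close>.\<close>
  define \<beta> where "\<beta> = (\<lambda>s. exp (- L * s) * max 0 a + exp (L * s) * min 0 a)"
  have barrier_c: "barrier k (s, c s) = \<beta> s" if "s \<ge> 0" for s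
    using origin_curve[OF c(1) that] by (simp add: barrier_def \<beta>_def a_def)
  have abs_\<beta>: "\<bar>\<beta> t\<bar> = exp (- L * t) * max 0 a - exp (L * t) * min 0 a"
    by (cases "a \<ge> 0") (simp_all add: \<beta>_def abs_mult)
  have D\<beta>: "(\<beta> has_real_derivative - L * \<bar>\<beta> t\<bar>) (at t)"
    unfolding abs_\<beta> unfolding \<beta>_def by (auto intro!: derivative_eq_intros simp: algebra_simps)
  have "(c has_vector_derivative V t (c t)) (at t within {0..})"
    using c(1) tx(2) unfolding curve_def by simp
  moreover have "at t within {0..} = at t" by (rule at_within_interior) (use tx(2) in simp)
  ultimately have Dc: "(c has_vector_derivative V t x) (at t)" using c(2) by simp
  have "((\<lambda>s. (s, c s)) has_derivative (\<lambda>s. (s, s *\<^sub>R V t x))) (at t)"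
    by (rule has_derivative_Pair[OF has_derivative_ident Dc[unfolded has_vector_derivative_def]])
  moreover have "(\<phi> has_derivative (\<lambda>h. h \<bullet> G z)) (at (t, c t))"
    using G(1) z tx(1) c(2) by (simp add: gderiv_def)
  ultimately have "((\<lambda>s. \<phi> (s, c s)) has_derivative (\<lambda>s. (s, s *\<^sub>R V t x) \<bullet> G z)) (at t)"
    by (rule has_derivative_compose)
  moreover have "(\<lambda>s. (s, s *\<^sub>R V t x) \<bullet> G z) = (*) (q + V t x \<bullet> p)"
    by (simp add: qp fun_eq_iff algebra_simps)
  ultimately have "((\<lambda>s. \<phi> (s, c s)) has_real_derivative (q + V t x \<bullet> p)) (at t)"
    by (simp add: has_field_derivative_def)
  from DERIV_diff[OF D\<beta> this]
  have D: "((\<lambda>s. \<beta> s - \<phi> (s, c s)) has_real_derivative (- L * \<bar>\<beta> t\<bar> - (q + V t x \<bullet> p))) (at t)" .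
  have "isCont (\<lambda>s. (s, c s)) t"
    by (rule continuous_Pair[OF continuous_ident has_vector_derivative_continuous[OF Dc]])
  then obtain d where d: "d > 0" "\<And>s. dist s t < d \<Longrightarrow> dist (s, c s) (t, c t) < e"
    using e(1) unfolding continuous_at_eps_delta by blast
  \<comment> \<open>Invariance of \<open>\<Omega>\<close> keeps the trajectory in \<open>Q\<close>,
    so the local maximum restricts to it, on both sides of \<open>t\<close> because
    \<open>t > 0\<close>.\<close>
  have "\<forall>s. \<bar>t - s\<bar> < min d t \<longrightarrow> \<beta> s - \<phi> (s, c s) \<le> \<beta> t - \<phi> (t, c t)"
  proof (intro allI impI)
    fix s assume s: "\<bar>t - s\<bar> < min d t"
    then have "s > 0" by linarith
    moreover have "c s \<in> \<Omega>" using curve_in_dom[OF c(1), of t s] c(2) tx \<open>s > 0\<close> by auto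
    moreover have "dist z (s, c s) < e"
      using d(2)[of s] s c(2) tx(1) by (simp add: dist_real_def dist_commute abs_minus_commute)
    ultimately show "\<beta> s - \<phi> (s, c s) \<le> \<beta> t - \<phi> (t, c t)"
      using e(2)[of "(s, c s)"] barrier_c[of s] barrier_c[of t] tx c(2) by auto
  qed
  from DERIV_local_max[OF D _ this] have "- L * \<bar>\<beta> t\<bar> - (q + V t x \<bullet> p) = 0" using d(1) tx(2) by simp
  moreover have "barrier k z = \<beta> t" using barrier_c[of t] tx c(2) by simp
  ultimately show "H z (barrier k z) (G z) \<le> 0"
    using h_le_transport[of t x "\<beta> t" p] tx qp by (simp add: H_def)
qed

lemma visc_sub_const: "visc_sub Q H (\<lambda>_. b)"
  unfolding visc_sub_def
proof (intro allI impI, elim conjE)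
  fix \<phi> G z
  assume G: "\<forall>y\<in>Q. GDERIV \<phi> y :> G y" and z: "z \<in> Q" and "local_max_at Q (\<lambda>y. b - \<phi> y) z"
  then obtain e where e: "e > 0" "\<And>y. y \<in> Q \<Longrightarrow> dist z y < e \<Longrightarrow> \<phi> z \<le> \<phi> y"
    unfolding local_max_at_def by auto
  have "(\<phi> has_derivative (\<lambda>h. h \<bullet> G z)) (at z)" using G z unfolding gderiv_def by blast
  moreover have "z \<in> Q \<inter> ball z e" "open (Q \<inter> ball z e)"
    using z e(1) open_Int[OF open_Q open_ball] by simp_all
  ultimately have "(\<lambda>h. h \<bullet> G z) = (\<lambda>h. 0)"
    using e(2) by (intro differential_zero_maxmin[of z "Q \<inter> ball z e" \<phi>]) auto
  then have "G z \<bullet> G z = 0" by meson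
  then have "G z = 0" by simp
  then show "H z b (G z) \<le> 0" using z h_gradient_0 by (auto simp: H_def zero_prod_def)
qed

text \<open>Perron's function and its lower envelope are extended by the barriers, which agree at
  time 0 and on the frontier. Comparison forces the two extensions to coincide, and this coincidence
  is continuity up to the boundary.\<close>

proposition dirichlet_problem:
  assumes k: "continuous_on (closure \<Omega>) k" and bdry: "\<And>x. x \<in> frontier \<Omega> \<Longrightarrow> k x = 0"
  obtains \<phi> M where "continuous_on E \<phi>" "\<And>z. z \<in> E \<Longrightarrow> \<bar>\<phi> z\<bar> \<le> M"
    "visc_sub Q H \<phi>" "visc_sub Q H (\<lambda>z. - \<phi> z)"
    "\<And>x. x \<in> closure \<Omega> \<Longrightarrow> \<phi> (0, x) = k x" "\<And>t x. t \<ge> 0 \<Longrightarrow> x \<in> frontier \<Omega> \<Longrightarrow> \<phi> (t, x) = 0"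
    "\<And>z. z \<in> E \<Longrightarrow> barrier k z \<le> \<phi> z" "\<And>z. z \<in> E \<Longrightarrow> \<phi> z \<le> - barrier (\<lambda>x. - k x) z"
proof -
  have "compact (closure \<Omega>)" using bounded_dom by simp
  then have "bounded (k ` closure \<Omega>)" by (intro compact_imp_bounded compact_continuous_image k)
  then obtain M where M: "M > 0" "\<And>x. x \<in> closure \<Omega> \<Longrightarrow> \<bar>k x\<bar> \<le> M"
    unfolding bounded_pos by auto
  define f where "f = (\<lambda>z. max (barrier k z) (- M))"
  define g where "g = (\<lambda>z. - max (barrier (\<lambda>x. - k x) z) (- M))"
  have cont: "continuous_on E f" "continuous_on E g"
    unfolding f_def g_def by (intro continuous_intros continuous_on_barrier k)+
  have QE: "Q \<subseteq> E" using closure_subset[of \<Omega>] by auto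
  \<comment> \<open>The transported initial function lies between the barriers and so orders
    them.\<close>
  have mid: "f z \<le> k (origin (fst z) (snd z))" "k (origin (fst z) (snd z)) \<le> g z" if "z \<in> E" for z
  proof -
    have "\<bar>k (origin (fst z) (snd z))\<bar> \<le> M" using that by (intro M origin_in_closure) auto
    then show "f z \<le> k (origin (fst z) (snd z))" "k (origin (fst z) (snd z)) \<le> g z"
      using barrier_le[of "fst z" k "snd z"] barrier_le[of "fst z" "\<lambda>x. - k x" "snd z"] that
      by (auto simp: f_def g_def)
  qed
  have fg: "f z \<le> g z" if "z \<in> E" for z using mid[OF that] by linarith
  have bound: "- M \<le> f z" "g z \<le> M" for z by (simp_all add: f_def g_def)
  have val0: "f (0, x) = k x" "g (0, x) = k x" if "x \<in> closure \<Omega>" for x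
    using M(2)[OF that] by (auto simp: f_def g_def barrier_0)
  have val_bdry: "f (t, x) = 0" "g (t, x) = 0" if "t \<ge> 0" "x \<in> frontier \<Omega>" for t x
    using bdry[OF origin_in_frontier[OF that]] M(1) by (simp_all add: f_def g_def barrier_def)
  have E_Q: "f z = g z" if z: "z \<in> E - Q" for z
  proof -
    obtain t x where tx: "z = (t, x)" by force
    have "t \<ge> 0" "x \<in> closure \<Omega>" using z tx by auto
    moreover have "t = 0 \<or> x \<in> frontier \<Omega>"
      using z tx open_dom by (auto simp: frontier_def interior_open)
    moreover note tx
    ultimately show ?thesis using val0 val_bdry by auto
  qed
  have odd: "odd_hamiltonian Q H" using open_Q continuous_on_H H_odd by (rule odd_hamiltonian.intro)
  have sub_f: "visc_sub Q H f" unfolding f_def by (intro visc_sub_max visc_sub_barrier visc_sub_const)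
  have sub_g: "visc_sub Q H (\<lambda>z. - g z)"
    unfolding g_def minus_minus by (intro visc_sub_max visc_sub_barrier visc_sub_const)
  have cont_Q: "continuous_on Q f" "continuous_on Q g" using cont QE continuous_on_subset by blast+
  have fgQ: "f z \<le> g z" if "z \<in> Q" for z using fg QE that by blast
  obtain u where u: "usc_on Q u" "\<And>y. y \<in> Q \<Longrightarrow> f y \<le> u y" "\<And>y. y \<in> Q \<Longrightarrow> u y \<le> g y"
    "visc_sub Q H u" "visc_sub Q H (upper_env Q (\<lambda>y. - u y))"
    using odd_hamiltonian.perron[OF odd cont_Q fgQ bound sub_f sub_g] by blast
  define N where "N = upper_env Q (\<lambda>y. - u y)"
  have negu: "- u y \<le> M" if "y \<in> Q" for y using u(2)[OF that] bound(1)[of y] by linarith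
  have N: "- u y \<le> N y" "N y \<le> - f y" if "y \<in> Q" for y
  proof -
    show "- u y \<le> N y" unfolding N_def by (rule upper_env_ge[OF negu that])
    show "N y \<le> - f y" unfolding N_def
      by (rule upper_env_le_usc[OF negu continuous_on_imp_usc_on[OF continuous_on_minus[OF cont_Q(1)]] _ that])
        (use u(2) in auto)
  qed
  have uscN: "usc_on Q N" unfolding N_def by (rule usc_on_upper_env[OF negu])
  define U where "U = (\<lambda>z. if z \<in> Q then u z else g z)"
  define W where "W = (\<lambda>z. if z \<in> Q then N z else - f z)"
  have uscU: "usc_on E U"
    unfolding U_def by (rule usc_on_extend[OF open_Q QE u(1) continuous_on_imp_usc_on[OF cont(2)] u(3)])
  have uscW: "usc_on E W"
    unfolding W_def
    by (rule usc_on_extend[OF open_Q QE uscN continuous_on_imp_usc_on[OF continuous_on_minus[OF cont(1)]] N(2)])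
  have subU: "visc_sub Q H U" using u(4) visc_sub_cong[of Q U u H] by (simp add: U_def)
  have subW: "visc_sub Q H W" using u(5) visc_sub_cong[of Q W N H] by (simp add: W_def N_def)
  have le0: "U z + W z \<le> 0" if "z \<in> E" for z
  proof (rule comparison[OF uscU uscW _ _ _ subU subW that])
    show "U z \<le> M" if "z \<in> E" for z using u(3)[of z] bound(2)[of z] by (fastforce simp: U_def)
    show "W z \<le> M" if "z \<in> E" for z using N(2)[of z] bound(1)[of z] by (fastforce simp: W_def)
    show "U z + W z \<le> 0" if "z \<in> E - Q" for z using E_Q[OF that] that by (auto simp: U_def W_def)
  qed
  \<comment> \<open>\<open>N\<close> lies above \<open>- u\<close> by construction and comparison
    gives the reverse; hence \<open>U\<close> and \<open>- U\<close> are both upper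
    semicontinuous.\<close>
  have W_eq: "W z = - U z" if "z \<in> E" for z
    using le0[OF that] N(1)[of z] E_Q[of z] that by (cases "z \<in> Q") (auto simp: U_def W_def)
  have contU: "continuous_on E U"
    using uscU uscW usc_on_cong[of E W "\<lambda>z. - U z"] W_eq by (intro usc_on_both_continuous) auto
  have fUg: "f z \<le> U z" "U z \<le> g z" if "z \<in> E" for z
    using u(2,3)[of z] fg[OF that] by (auto simp: U_def)
  show thesis
  proof
    show "continuous_on E U" by (rule contU)
    show "\<bar>U z\<bar> \<le> M" if "z \<in> E" for z using fUg[OF that] bound[of z] by linarith
    show "visc_sub Q H U" by (rule subU)
    show "visc_sub Q H (\<lambda>z. - U z)"
      using subW visc_sub_cong[of Q W "\<lambda>z. - U z" H] W_eq QE by blast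
    show "U (0, x) = k x" if "x \<in> closure \<Omega>" for x using val0[OF that] by (simp add: U_def)
    show "U (t, x) = 0" if "t \<ge> 0" "x \<in> frontier \<Omega>" for t x
      using val_bdry[OF that] fUg[of "(t, x)"] that by (auto simp: frontier_def)
    show "barrier k z \<le> U z" if "z \<in> E" for z using fUg(1)[OF that] by (simp add: f_def)
    show "U z \<le> - barrier (\<lambda>x. - k x) z" if "z \<in> E" for z using fUg(2)[OF that] by (simp add: g_def)
  qed
qed

lemma barrier_pos: "k (origin t x) > 0 \<Longrightarrow> barrier k (t, x) > 0"
  by (simp add: barrier_def)

lemma barrier_zero: "k (origin t x) = 0 \<Longrightarrow> barrier k (t, x) = 0"
  by (simp add: barrier_def)

text \<open>Subsolution test for \<open>u\<close> and for \<open>- w\<close>: by oddness these express sub- and supersolution.\<close>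

lemma dirichlet_unique:
  assumes "continuous_on E u" "continuous_on E w"
    and "visc_sub Q H u" "visc_sub Q H (\<lambda>z. - w z)"
    and "bdd_above (u ` E)" "bdd_below (w ` E)" "\<And>z. z \<in> E - Q \<Longrightarrow> u z \<le> w z" "z \<in> E"
  shows "u z \<le> w z"
proof -
  obtain M1 M2 where M: "\<And>z. z \<in> E \<Longrightarrow> u z \<le> M1" "\<And>z. z \<in> E \<Longrightarrow> M2 \<le> w z"
    using assms(5,6) unfolding bdd_above_def bdd_below_def by blast
  have "u z + - w z \<le> 0"
  proof (rule comparison[where M = "max M1 (- M2)"])
    show "usc_on E u" "usc_on E (\<lambda>z. - w z)"
      by (intro continuous_on_imp_usc_on continuous_intros assms)+
    show "u y \<le> max M1 (- M2)" "- w y \<le> max M1 (- M2)" if "y \<in> E" for y using M[OF that] by auto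
    show "u y + - w y \<le> 0" if "y \<in> E - Q" for y using assms(7)[OF that] by simp
  qed (use assms in auto)
  then show ?thesis by simp
qed

end

section \<open>Cut-off and the Hamiltonian of the level set equation\<close>

context
  fixes rs :: real and \<eta> :: "real \<Rightarrow> real"
  assumes cutoff: "cutoff rs \<eta>"
begin

lemma cutoff_denominator_pos: "(norm (p :: 'a::real_normed_vector))\<^sup>2 + \<eta> ((norm p)\<^sup>2) > 0"
proof (cases "p = 0")
  case True
  then show ?thesis using cutoff by (simp add: cutoff_def)
next
  case False
  then have "0 < (norm p)\<^sup>2" by simp
  moreover have "0 \<le> \<eta> ((norm p)\<^sup>2)" using cutoff by (simp add: cutoff_def)
  ultimately show ?thesis by linarith
qed

text \<open>The displacement per unit of value, multiplied by |p|, is at most 1 whatever the size of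
  \<open>p\<close>. This is the source of the Lipschitz bound in the value.\<close>

lemma cutoff_ratio_le: "norm (p :: 'a::real_normed_vector) / ((norm p)\<^sup>2 + \<eta> ((norm p)\<^sup>2)) * norm p \<le> 1"
proof -
  have "(norm p)\<^sup>2 \<le> (norm p)\<^sup>2 + \<eta> ((norm p)\<^sup>2)" using cutoff by (simp add: cutoff_def)
  then show ?thesis using cutoff_denominator_pos[of p] by (simp add: power2_eq_square divide_le_eq)
qed

lemma continuous_on_cutoff: "continuous_on {0..} \<eta>"
proof -
  obtain f' where "\<And>z. z \<in> {0..} \<Longrightarrow> (\<eta> has_derivative blinfun_apply (f' z)) (at z within {0..})"
    using cutoff unfolding cutoff_def C1_on_def by blast
  then show ?thesis by (rule has_derivative_continuous_on)
qed

end

text \<open>A joint change of sign of \<open>u\<close> and \<open>p\<close> leaves the displaced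
  point fixed, whence oddness. The Lipschitz constant of the extension serves for \<open>x\<close>
  and, by \<open>cutoff_ratio_le\<close>, for the value as well; it has to be a constant on the
  whole space because the displaced point may leave \<open>closure \<Omega>\<close>.\<close>

lemma level_set_transport:
  fixes \<Omega> :: "(real^3) set" and v V :: "real \<Rightarrow> real^3 \<Rightarrow> real^3"
  assumes "open \<Omega>" "bounded \<Omega>"
    and tan: "velocity_tangential \<Omega> v" and ext: "velocity_extension \<Omega> v V" and cut: "cutoff rs \<eta>"
  defines "h \<equiv> \<lambda>t x u p. V t (x - (u / ((norm p)\<^sup>2 + \<eta> ((norm p)\<^sup>2))) *\<^sub>R p) \<bullet> p"
  obtains L where "transport_hamiltonian h L \<Omega> V"
proof -
  obtain L where L: "\<And>t. t \<ge> 0 \<Longrightarrow> L-lipschitz_on UNIV (V t)"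
    and V_cont: "continuous_on ({0..} \<times> UNIV) (\<lambda>(t, x). V t x)"
    using ext unfolding velocity_extension_def by blast
  have L0: "L \<ge> 0" using L[of 0] lipschitz_on_nonneg by auto
  have V_lip: "norm (V t x - V t y) \<le> L * norm (x - y)" if "t \<ge> 0" for t x y
    using lipschitz_onD[OF L[OF that], of x y] by (simp add: dist_norm)
  have "transport_hamiltonian h L \<Omega> V"
  proof
    show "open \<Omega>" "bounded \<Omega>" "L \<ge> 0" by fact+
    show "continuous_on ({0..} \<times> UNIV) (\<lambda>(t, x). V t x)" by fact
    show "norm (V t x - V t y) \<le> L * norm (x - y)" if "t \<ge> 0" for t x y by (rule V_lip[OF that])
    show "h t x (- a) (- p) = - h t x a p" for t x a p by (simp add: h_def)
    show "h t x 0 p = V t x \<bullet> p" for t x p by (simp add: h_def)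
    show "h t x a 0 = 0" for t x a by (simp add: h_def)
    show "V s y \<in> bouligand_cone (frontier \<Omega>) y \<and> - V s y \<in> bouligand_cone (frontier \<Omega>) y"
      if "s \<ge> 0" "y \<in> frontier \<Omega>" for s y
    proof -
      have "V s y = v s y" using ext that by (simp add: velocity_extension_def frontier_def)
      then show ?thesis using tan that by (simp add: velocity_tangential_def)
    qed
    show "\<bar>h t x a p - h t y b p\<bar> \<le> L * (norm (x - y) * norm p + \<bar>a - b\<bar>)" if "t \<ge> 0" for t x a p y b
    proof -
      define d where "d = (norm p)\<^sup>2 + \<eta> ((norm p)\<^sup>2)"
      have d: "d > 0" unfolding d_def by (rule cutoff_denominator_pos[OF cut])
      have "norm p / d * norm p \<le> 1" unfolding d_def by (rule cutoff_ratio_le[OF cut])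
      then have r: "\<bar>a - b\<bar> * (norm p / d * norm p) \<le> \<bar>a - b\<bar> * 1" by (intro mult_left_mono) auto
      have "\<bar>h t x a p - h t y b p\<bar> = \<bar>(V t (x - (a / d) *\<^sub>R p) - V t (y - (b / d) *\<^sub>R p)) \<bullet> p\<bar>"
        by (simp add: h_def d_def inner_diff_left)
      also have "\<dots> \<le> norm (V t (x - (a / d) *\<^sub>R p) - V t (y - (b / d) *\<^sub>R p)) * norm p"
        by (rule Cauchy_Schwarz_ineq2)
      also have "\<dots> \<le> L * norm ((x - (a / d) *\<^sub>R p) - (y - (b / d) *\<^sub>R p)) * norm p"
        by (intro mult_right_mono V_lip that) simp
      also have "(x - (a / d) *\<^sub>R p) - (y - (b / d) *\<^sub>R p) = (x - y) - ((a - b) / d) *\<^sub>R p"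
        by (simp add: diff_divide_distrib scaleR_diff_left)
      also have "L * norm ((x - y) - ((a - b) / d) *\<^sub>R p) * norm p \<le>
          L * (norm (x - y) + \<bar>a - b\<bar> / d * norm p) * norm p"
        using norm_triangle_ineq4[of "x - y" "((a - b) / d) *\<^sub>R p"] d L0
        by (intro mult_right_mono mult_left_mono) auto
      also have "\<dots> = L * (norm (x - y) * norm p + \<bar>a - b\<bar> * (norm p / d * norm p))"
        by (simp add: algebra_simps)
      also have "\<dots> \<le> L * (norm (x - y) * norm p + \<bar>a - b\<bar>)"
        using r L0 by (intro mult_left_mono) auto
      finally show ?thesis .
    qed
    have "continuous_on ({0..} \<times> UNIV) (\<lambda>w :: real \<times> (real^3) \<times> real \<times> (real^3). \<eta> ((norm (snd (snd (snd w))))\<^sup>2))"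
      by (rule continuous_on_compose2[OF continuous_on_cutoff[OF cut]]) (auto intro!: continuous_intros)
    then have g: "continuous_on ({0..} \<times> UNIV) (\<lambda>w :: real \<times> (real^3) \<times> real \<times> (real^3).
        fst (snd w) - (fst (snd (snd w)) / ((norm (snd (snd (snd w))))\<^sup>2 + \<eta> ((norm (snd (snd (snd w))))\<^sup>2)))
          *\<^sub>R snd (snd (snd w)))" (is "continuous_on _ ?g")
      by (intro continuous_intros ballI, assumption) (rule less_imp_neq[OF cutoff_denominator_pos[OF cut], symmetric])
    have p: "continuous_on ({0..} \<times> UNIV) (\<lambda>w :: real \<times> (real^3) \<times> real \<times> (real^3). snd (snd (snd w)))"
      by (intro continuous_intros)
    have "continuous_on ({0..} \<times> UNIV) (\<lambda>w. (fst w, ?g w))"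
      by (rule continuous_on_Pair[OF continuous_on_fst[OF continuous_on_id] g])
    then have "continuous_on ({0..} \<times> UNIV) (\<lambda>w. (\<lambda>(t, x). V t x) (fst w, ?g w))"
      by (rule continuous_on_compose2[OF V_cont]) auto
    from continuous_on_inner[OF this p]
    have "continuous_on ({0..} \<times> UNIV) (\<lambda>w. (\<lambda>(t, x). V t x) (fst w, ?g w) \<bullet> snd (snd (snd w)))" .
    then show "continuous_on ({0..} \<times> UNIV) (\<lambda>(t, x, u, p). h t x u p)"
      by (simp add: h_def case_prod_beta)
  qed
  then show thesis by (rule that)
qed

theorem theorem2p8:
  fixes \<Omega> \<Omega>p \<Omega>m \<Sigma> :: "(real^3) set"
    and v V :: "real \<Rightarrow> real^3 \<Rightarrow> real^3"
    and \<eta> :: "real \<Rightarrow> real" and rs :: real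
    and \<phi>0 :: "real^3 \<Rightarrow> real"
  assumes "open \<Omega>" and "connected \<Omega>" and "bounded \<Omega>"
    and "velocity_regular \<Omega> v" and "velocity_tangential \<Omega> v"
    and "velocity_extension \<Omega> v V"
    and "cutoff rs \<eta>"
    and "\<Omega>p \<subseteq> \<Omega>" and "open \<Omega>p" and "connected \<Omega>p" and "\<Omega>p \<noteq> {}"
    and "\<Sigma> = frontier \<Omega>p" and "closed_C2_surface \<Sigma>" and "\<Sigma> \<inter> frontier \<Omega> = {}"
    and "\<Omega>m = \<Omega> - (\<Omega>p \<union> \<Sigma>)"
    and "continuous_on (closure \<Omega>) \<phi>0"
    and "\<forall>x\<in>\<Omega>p. \<phi>0 x > 0" and "\<forall>x\<in>\<Omega>m. \<phi>0 x < 0"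
    and "{x\<in>\<Omega>. \<phi>0 x = 0} = \<Sigma>" and "\<forall>x\<in>frontier \<Omega>. \<phi>0 x = 0"
  shows "\<exists>\<phi>. level_set_solution \<Omega> V \<eta> \<phi>0 \<phi> \<and>
           (\<forall>\<psi>. level_set_solution \<Omega> V \<eta> \<phi>0 \<psi> \<longrightarrow>
              (\<forall>t\<ge>0. \<forall>x\<in>closure \<Omega>. \<psi> (t, x) = \<phi> (t, x))) \<and>
           (\<forall>t\<ge>0. (\<forall>x\<in>flow \<Omega> v t 0 ` \<Omega>p. \<phi> (t, x) > 0) \<and>
                  (\<forall>x\<in>flow \<Omega> v t 0 ` \<Omega>m. \<phi> (t, x) < 0) \<and>
                  (\<forall>x\<in>flow \<Omega> v t 0 ` \<Sigma>. \<phi> (t, x) = 0))"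
proof -
  define h where "h = (\<lambda>t x u p. V t (x - (u / ((norm p)\<^sup>2 + \<eta> ((norm p)\<^sup>2))) *\<^sub>R p) \<bullet> p)"
  obtain L where "transport_hamiltonian h L \<Omega> V"
    using level_set_transport[OF assms(1,3,5,6,7)] unfolding h_def by blast
  then interpret transport_hamiltonian h L \<Omega> V .
  have op: "level_set_op V \<eta> = H"
    unfolding level_set_op_def H_def unfolding h_def ..
  have QE: "Q \<subseteq> E" using closure_subset[of \<Omega>] by auto
  obtain \<phi> M where cont: "continuous_on E \<phi>" and bound: "\<And>z. z \<in> E \<Longrightarrow> \<bar>\<phi> z\<bar> \<le> M"
    and sub: "visc_sub Q H \<phi>" "visc_sub Q H (\<lambda>z. - \<phi> z)"
    and init: "\<And>x. x \<in> closure \<Omega> \<Longrightarrow> \<phi> (0, x) = \<phi>0 x"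
    and bdry: "\<And>t x. t \<ge> 0 \<Longrightarrow> x \<in> frontier \<Omega> \<Longrightarrow> \<phi> (t, x) = 0"
    and lower: "\<And>z. z \<in> E \<Longrightarrow> barrier \<phi>0 z \<le> \<phi> z"
    and upper: "\<And>z. z \<in> E \<Longrightarrow> \<phi> z \<le> - barrier (\<lambda>x. - \<phi>0 x) z"
    using dirichlet_problem[OF assms(16), OF assms(20)[rule_format]] by blast
  have bound_Q: "\<bar>\<phi> z\<bar> \<le> M" if "z \<in> Q" for z using bound QE that by blast
  have cont_Q: "continuous_on Q \<phi>" using cont QE by (rule continuous_on_subset)
  have "viscosity_subsolution Q H \<phi>" using open_Q cont_Q bound_Q sub(1) by (rule subsolution_of_visc_sub)
  moreover have "viscosity_supersolution Q H \<phi>"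
    using open_Q cont_Q bound_Q sub(2) H_odd by (rule supersolution_of_visc_sub)
  ultimately have solution: "level_set_solution \<Omega> V \<eta> \<phi>0 \<phi>"
    using cont init bdry closure_subset[of \<Omega>]
    by (auto simp: level_set_solution_def viscosity_solution_def op)
  have unique: "\<psi> (t, x) = \<phi> (t, x)"
    if \<psi>: "level_set_solution \<Omega> V \<eta> \<phi>0 \<psi>" and tx: "t \<ge> 0" "x \<in> closure \<Omega>" for \<psi> t x
  proof -
    have cont_\<psi>: "continuous_on E \<psi>" and visc: "viscosity_subsolution Q H \<psi>" "viscosity_supersolution Q H \<psi>"
      and init_\<psi>: "\<And>x. x \<in> \<Omega> \<Longrightarrow> \<psi> (0, x) = \<phi>0 x"
      and bdry_\<psi>: "\<And>t x. t \<ge> 0 \<Longrightarrow> x \<in> frontier \<Omega> \<Longrightarrow> \<psi> (t, x) = 0"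
      using \<psi> by (auto simp: level_set_solution_def viscosity_solution_def op)
    have cont_\<psi>Q: "continuous_on Q \<psi>" using cont_\<psi> QE by (rule continuous_on_subset)
    have sub_\<psi>: "visc_sub Q H \<psi>" using cont_\<psi>Q visc(1) by (rule visc_sub_of_subsolution)
    have super_\<psi>: "visc_sub Q H (\<lambda>z. - \<psi> z)"
      using cont_\<psi>Q visc(2) H_odd by (rule visc_sub_of_supersolution)
    \<comment> \<open>At time 0 the initial condition is imposed only on \<open>\<Omega>\<close>;
      points with \<open>y \<in> frontier \<Omega>\<close> are settled by the boundary
      condition.\<close>
    have eq: "\<psi> z = \<phi> z" if z: "z \<in> E - Q" for z
    proof -
      obtain s y where sy: "z = (s, y)" by force
      have "s \<ge> 0" "y \<in> closure \<Omega>" "s = 0 \<and> y \<in> \<Omega> \<or> y \<in> frontier \<Omega>"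
        using z sy open_dom by (auto simp: frontier_def interior_open)
      then show ?thesis using sy bdry bdry_\<psi> init init_\<psi> by auto
    qed
    \<comment> \<open>Comparison asks for bounds uniform in time. On \<open>Q\<close> they are part
      of the notions of sub- and supersolution; elsewhere those of \<open>\<phi>\<close> are
      used.\<close>
    have "bdd_above (usc_env Q \<psi> ` Q)" using visc(1) unfolding viscosity_subsolution_def by (elim conjE)
    then obtain M1 where M1: "\<And>z. z \<in> Q \<Longrightarrow> usc_env Q \<psi> z \<le> M1" unfolding bdd_above_def by blast
    have "bdd_below (lsc_env Q \<psi> ` Q)" using visc(2) unfolding viscosity_supersolution_def by (elim conjE)
    then obtain M2 where M2: "\<And>z. z \<in> Q \<Longrightarrow> M2 \<le> lsc_env Q \<psi> z" unfolding bdd_below_def by blast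
    have M\<psi>: "\<psi> z \<le> max M1 M" "min M2 (- M) \<le> \<psi> z" if "z \<in> E" for z
    proof -
      have "\<psi> z \<le> max M1 M \<and> min M2 (- M) \<le> \<psi> z"
      proof (cases "z \<in> Q")
        case True
        then show ?thesis
          using M1[OF True] M2[OF True] usc_env_eq[OF cont_\<psi>Q True] lsc_env_eq[OF cont_\<psi>Q True] by linarith
      next
        case False
        then have "\<psi> z = \<phi> z" using eq that by blast
        then show ?thesis using bound[OF that] by linarith
      qed
      then show "\<psi> z \<le> max M1 M" "min M2 (- M) \<le> \<psi> z" by auto
    qed
    have bdd: "bdd_above (\<psi> ` E)" "bdd_below (\<psi> ` E)" "bdd_above (\<phi> ` E)" "bdd_below (\<phi> ` E)"
    proof -
      show "bdd_above (\<psi> ` E)" using M\<psi>(1) by (rule bdd_aboveI2)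
      show "bdd_below (\<psi> ` E)" using M\<psi>(2) by (rule bdd_belowI2)
      show "bdd_above (\<phi> ` E)" by (rule bdd_aboveI2[of _ _ M]) (use bound abs_le_D1 in blast)
      show "bdd_below (\<phi> ` E)"
      proof (rule bdd_belowI2[of _ "- M"])
        show "- M \<le> \<phi> z" if "z \<in> E" for z using bound[OF that] by linarith
      qed
    qed
    have "(t, x) \<in> E" using tx by simp
    then show ?thesis
      using dirichlet_unique[OF cont_\<psi> cont sub_\<psi> sub(2) bdd(1,4) eq_refl[OF eq]]
        dirichlet_unique[OF cont cont_\<psi> sub(1) super_\<psi> bdd(3,2) eq_refl[OF eq[symmetric]]]
      by (intro order_antisym)
  qed
  \<comment> \<open>Trajectories of \<open>v\<close> are the curves of \<open>V\<close> that stay in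
    \<open>closure \<Omega>\<close>, so uniqueness resolves the description in \<open>flow\<close>,
    and \<open>origin t\<close> undoes the flow map.\<close>
  have flow: "flow \<Omega> v t 0 \<xi> \<in> closure \<Omega> \<and> origin t (flow \<Omega> v t 0 \<xi>) = \<xi>"
    if t: "t \<ge> 0" and \<xi>: "\<xi> \<in> closure \<Omega>" for t \<xi>
  proof -
    have Vv: "V s y = v s y" if "s \<ge> 0" "y \<in> closure \<Omega>" for s y
      using assms(6) that by (simp add: velocity_extension_def)
    obtain c where c: "curve c" "c 0 = \<xi>" using curve_exists[of 0 \<xi>] by auto
    have c_in: "c s \<in> closure \<Omega>" if "s \<ge> 0" for s
      using curve_in_closure[OF c(1), of 0 s] c(2) \<xi> that by simp
    then have "trajectory \<Omega> v c" using c(1) Vv by (simp add: trajectory_def curve_def)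
    moreover have "x t = c t" if "trajectory \<Omega> v x" "x 0 = \<xi>" for x
    proof -
      have "curve x" using that(1) Vv by (simp add: trajectory_def curve_def)
      then show ?thesis using curve_dist[OF _ c(1) t order_refl, of x] that(2) c(2) by simp
    qed
    ultimately have "flow \<Omega> v t 0 \<xi> = c t"
      unfolding flow_def using c(2) by (intro the_equality) blast+
    then show ?thesis using c_in[OF t] origin_curve[OF c(1) t] c(2) by simp
  qed
  \<comment> \<open>Both barriers carry the sign of the initial value at the origin of the point:
    the lower one settles positivity, the upper one negativity, and where that value is zero both
    vanish.\<close>
  have signs: "\<phi>0 \<xi> > 0 \<Longrightarrow> \<phi> (t, flow \<Omega> v t 0 \<xi>) > 0" "\<phi>0 \<xi> < 0 \<Longrightarrow> \<phi> (t, flow \<Omega> v t 0 \<xi>) < 0"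
      "\<phi>0 \<xi> = 0 \<Longrightarrow> \<phi> (t, flow \<Omega> v t 0 \<xi>) = 0"
    if "t \<ge> 0" "\<xi> \<in> \<Omega>" for t \<xi>
  proof -
    let ?x = "flow \<Omega> v t 0 \<xi>"
    have x: "(t, ?x) \<in> E" "origin t ?x = \<xi>" using flow[of t \<xi>] that closure_subset by auto
    show "\<phi> (t, ?x) > 0" if "\<phi>0 \<xi> > 0"
      using lower[OF x(1)] barrier_pos[of \<phi>0 t ?x] x(2) that by simp
    show "\<phi> (t, ?x) < 0" if "\<phi>0 \<xi> < 0"
      using upper[OF x(1)] barrier_pos[of "\<lambda>x. - \<phi>0 x" t ?x] x(2) that by simp
    show "\<phi> (t, ?x) = 0" if "\<phi>0 \<xi> = 0"
      using lower[OF x(1)] upper[OF x(1)] barrier_zero[of \<phi>0 t ?x] barrier_zero[of "\<lambda>x. - \<phi>0 x" t ?x]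
        x(2) that by simp
  qed
  have "\<Omega>m \<subseteq> \<Omega>" "\<Sigma> \<subseteq> \<Omega>" "\<forall>x\<in>\<Sigma>. \<phi>0 x = 0" using assms(15,19) by auto
  then have "\<forall>t\<ge>0. (\<forall>x\<in>flow \<Omega> v t 0 ` \<Omega>p. \<phi> (t, x) > 0) \<and>
      (\<forall>x\<in>flow \<Omega> v t 0 ` \<Omega>m. \<phi> (t, x) < 0) \<and> (\<forall>x\<in>flow \<Omega> v t 0 ` \<Sigma>. \<phi> (t, x) = 0)"
    using signs assms(8,17,18) by (simp add: subset_iff)
  then show ?thesis using solution unique by blast
qed

end
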